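(* Let $A\subset\mathbb{R}^n$ be a smooth set with $|A|>0$ and $|\mathbb{R}^n\setminus A|>0$. Fix $0<\alpha<1$. Then the set $$E(A,\alpha)=\left\{x\in\mathbb{R}^n:\ \lim_{h\to 0} D(Q(x,h))=\alpha\right\}$$ has Hausdorff dimension $n$.
   Context: $|\cdot|$ denotes Lebesgue measure in $\mathbb{R}^n$. A cube means a cube in $\mathbb{R}^n$ with sides parallel to the coordinate axes; $l(Q)$ is the sidelength of a cube $Q$. Two cubes $Q,Q'$ with $l(Q)=l(Q')$ are called consecutive if the intersection of their closures is one of their ($(n-1)$-dimensional) faces. For a measurable set $A\subset\mathbb{R}^n$, the density of $A$ in a cube $Q$ is $D(Q)=|A\cap Q|/|Q|$. A measurable set $A\subset\mathbb{R}^n$ is called smooth (in $\mathbb{R}^n$) if $$\lim_{\delta\to 0}\ \sup|D(Q)-D(Q')|=0,$$ where the supremum is taken over all pairs of consecutive cubes $Q,Q'$ with $l(Q)=l(Q')\le\delta$. For $x\in\mathbb{R}^n$ and $h>0$, $Q(x,h)$ denotes the cube centered at $x$ of sidelength $h$. *)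

theory Defs
  imports "HOL-Analysis.Analysis"
begin

section \<open>Hausdorff measure and dimension\<close>

text \<open>The weight \<open>diam(U)^s\<close>, with the conventions \<open>diam({})^s = 0\<close> and \<open>0^0 = 1\<close> for a
  nonempty set (the library has \<open>0 powr 0 = 0\<close>), so that the case \<open>s = 0\<close> gives counting
  measure.\<close>

definition diam_weight :: "real \<Rightarrow> 'a::metric_space set \<Rightarrow> ennreal" where
  "diam_weight s U =
    (if U = {} then 0 else if s = 0 then 1 else ennreal (diameter U powr s))"

text \<open>Covering sets are required to be bounded since \<^const>\<open>diameter\<close> is unspecified on
  unbounded sets.\<close>

definition hausdorff_premeasure :: "real \<Rightarrow> real \<Rightarrow> 'a::metric_space set \<Rightarrow> ennreal" where
  "hausdorff_premeasure s \<delta> E =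
    (INF U \<in> {U :: nat \<Rightarrow> 'a set. E \<subseteq> (\<Union>i. U i) \<and> (\<forall>i. bounded (U i) \<and> diameter (U i) \<le> \<delta>)}.
      \<Sum>i. diam_weight s (U i))"

definition hausdorff_measure :: "real \<Rightarrow> 'a::metric_space set \<Rightarrow> ennreal" where
  "hausdorff_measure s E = (SUP \<delta> \<in> {0<..}. hausdorff_premeasure s \<delta> E)"

definition hausdorff_dim :: "'a::metric_space set \<Rightarrow> ereal" where
  "hausdorff_dim E = (INF s \<in> {s. 0 \<le> s \<and> hausdorff_measure s E = 0}. ereal s)"

section \<open>Cubes, densities and smooth sets\<close>

text \<open>Cubes are taken closed; adding or removing boundary points changes neither densities
  nor closures.\<close>

definition cube :: "real ^ 'n \<Rightarrow> real \<Rightarrow> (real ^ 'n) set" where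
  "cube x h = cbox (x - vec (h / 2)) (x + vec (h / 2))"

definition consecutive :: "(real ^ 'n) set \<Rightarrow> (real ^ 'n) set \<Rightarrow> bool" where
  "consecutive Q Q' \<longleftrightarrow>
    (closure Q \<inter> closure Q') facet_of closure Q \<and> (closure Q \<inter> closure Q') facet_of closure Q'"

definition set_density :: "(real ^ 'n) set \<Rightarrow> (real ^ 'n) set \<Rightarrow> real" where
  "set_density A Q = measure lebesgue (A \<inter> Q) / measure lebesgue Q"

text \<open>For \<open>\<delta> > 0\<close> the supremum is that of a nonempty subset of \<open>{0..1}\<close>.\<close>

definition smooth_set :: "(real ^ 'n) set \<Rightarrow> bool" where
  "smooth_set A \<longleftrightarrow>
    A \<in> sets lebesgue \<and>
    ((\<lambda>\<delta>. Sup {\<bar>set_density A (cube x h) - set_density A (cube y h)\<bar> | x y h.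
                0 < h \<and> h \<le> \<delta> \<and> consecutive (cube x h) (cube y h)}) \<longlongrightarrow> 0) (at_right 0)"

end

theory Submission
  imports Defs
begin

text \<open>Write \<open>D\<close> for the density of \<open>A\<close> in dyadic cubes. Along the dyadic filtration \<open>D\<close> is a bounded
  martingale which tends to \<open>0\<close> or \<open>1\<close> almost everywhere, and smoothness makes its increments at
  level \<open>m\<close> at most \<open>w m\<close>, where \<open>w m \<longlonglongrightarrow> 0\<close>. Start from a cube \<open>p\<close> of level \<open>m\<close> with \<open>D\<close> near \<open>\<alpha>\<close> and
  wait until \<open>D\<close> has risen to \<open>\<alpha> + K w m\<close> (giving up at \<open>\<alpha> - K w m\<close>) and then returned to \<open>\<alpha>\<close>
  (giving up at \<open>\<alpha> + 2 K w m\<close>). By optional stopping each phase succeeds on at least a quarter of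
  the volume, and it takes at least about \<open>K\<close> steps. So \<open>p\<close> has subcubes with \<open>D\<close> near \<open>\<alpha>\<close>, much
  smaller than \<open>p\<close>, that fill a fixed proportion of its volume, and between them and \<open>p\<close> the density
  stays within \<open>3 K w m\<close> of \<open>\<alpha>\<close>.

  Let \<open>s < n\<close> and take boxes of radii \<open>r i\<close> with small \<open>\<Sum>i. r i powr s\<close>. If \<open>K\<close> is large,
  volume counting yields one of these subcubes \<open>q\<close> for which the boxes meeting \<open>q\<close> again have small
  total weight relative to \<open>(side q) powr s\<close>. Iterating gives a point where the density is \<open>\<alpha>\<close> and
  which no box covers, so the \<open>s\<close>-dimensional measure is positive without any mass distribution being
  constructed.\<close>

section \<open>Cubes and grids\<close>

lemma mem_cube: "u \<in> cube x h \<longleftrightarrow> (\<forall>i. \<bar>u $ i - x $ i\<bar> \<le> h / 2)"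
  by (auto simp: cube_def mem_box_cart abs_le_iff algebra_simps) (smt (verit) field_sum_of_halves)+

lemma measure_cube:
  fixes x :: "real ^ 'n"
  assumes "0 \<le> h"
  shows "measure lebesgue (cube x h) = h ^ CARD('n)"
proof -
  have "x \<in> cube x h"
    using assms by (simp add: mem_cube)
  then have "cube x h \<noteq> {}"
    by blast
  then show ?thesis
    unfolding cube_def by (simp add: content_cbox_cart)
qed

lemma cube_lmeasurable [simp]: "cube x h \<in> lmeasurable"
  by (simp add: cube_def)

lemma cube_sets [simp]: "cube x h \<in> sets lebesgue"
  by (simp add: cube_def)

lemma set_density_bounds:
  assumes "A \<in> sets lebesgue"
  shows "0 \<le> set_density A (cube x h)" "set_density A (cube x h) \<le> 1"
proof -
  show "0 \<le> set_density A (cube x h)"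
    by (simp add: set_density_def)
  have "measure lebesgue (A \<inter> cube x h) \<le> measure lebesgue (cube x h)"
    by (rule measure_mono_fmeasurable) (use assms in auto)
  then show "set_density A (cube x h) \<le> 1"
    by (simp add: set_density_def divide_le_eq_1 zero_less_measure_iff)
qed

text \<open>The cubes share their slice by the hyperplane \<open>?H\<close>, which supports both, so
  the slice is a face of each. It has dimension n - 1 because it contains the part of
  \<open>?H\<close> inside an open box about \<open>p\<close>, the centre of the slice.\<close>

lemma consecutive_axis:
  fixes y :: "real ^ 'n"
  assumes h: "0 < h"
  shows "consecutive (cube y h) (cube (y + axis i h) h)"
proof -
  define c where "c = y $ i + h / 2"
  let ?Q = "cube y h" and ?R = "cube (y + axis i h) h"
  let ?H = "{x :: real ^ 'n. axis i 1 \<bullet> x = c}"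
  have H: "x \<in> ?H \<longleftrightarrow> x $ i = c" for x
    by (simp add: inner_axis')
  have R_iff: "x \<in> ?R \<longleftrightarrow> \<bar>x $ i - y $ i - h\<bar> \<le> h / 2 \<and> (\<forall>j. j \<noteq> i \<longrightarrow> \<bar>x $ j - y $ j\<bar> \<le> h / 2)" for x
    by (auto simp: mem_cube axis_def algebra_simps)
  have Q_iff: "x \<in> ?Q \<longleftrightarrow> \<bar>x $ i - y $ i\<bar> \<le> h / 2 \<and> (\<forall>j. j \<noteq> i \<longrightarrow> \<bar>x $ j - y $ j\<bar> \<le> h / 2)" for x
    unfolding mem_cube by metis
  have "\<bar>u - y $ i\<bar> \<le> h / 2 \<and> \<bar>u - y $ i - h\<bar> \<le> h / 2 \<longleftrightarrow> u = c" for u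
    using h unfolding c_def by (smt (verit) field_sum_of_halves)
  then have Q: "?Q \<inter> ?R = ?Q \<inter> ?H" and R: "?Q \<inter> ?R = ?R \<inter> ?H"
    unfolding set_eq_iff Int_iff H R_iff Q_iff by blast+
  have conv: "convex (cube z h)" for z :: "real ^ 'n"
    by (simp add: cube_def convex_box)
  have face: "(?Q \<inter> ?R) face_of ?Q"
    unfolding Q
  proof (rule face_of_Int_supporting_hyperplane_le[OF conv])
    fix x assume "x \<in> ?Q"
    then have "\<bar>x $ i - y $ i\<bar> \<le> h / 2"
      by (simp add: Q_iff)
    then show "axis i 1 \<bullet> x \<le> c"
      unfolding inner_axis' inner_real_def mult_1 c_def by linarith
  qed
  have face': "(?Q \<inter> ?R) face_of ?R"
    unfolding R
  proof (rule face_of_Int_supporting_hyperplane_ge[OF conv])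
    fix x assume "x \<in> ?R"
    then have "\<bar>x $ i - y $ i - h\<bar> \<le> h / 2"
      by (simp add: R_iff)
    then show "axis i 1 \<bullet> x \<ge> c"
      unfolding inner_axis' inner_real_def mult_1 c_def by linarith
  qed
  define p where "p = y + axis i (h / 2)"
  let ?B = "box (p - vec (h / 2)) (p + vec (h / 2))"
  have sub: "?H \<inter> ?B \<subseteq> ?Q \<inter> ?R"
  proof
    fix x assume x: "x \<in> ?H \<inter> ?B"
    have "\<bar>x $ j - y $ j\<bar> \<le> h / 2" if "j \<noteq> i" for j
    proof -
      have "y $ j - h / 2 < x $ j" "x $ j < y $ j + h / 2"
        using x that by (auto simp: mem_box_cart p_def axis_def dest!: spec[of _ j])
      then show ?thesis
        by linarith
    qed
    moreover have "\<bar>x $ i - y $ i\<bar> \<le> h / 2"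
      using x h unfolding Int_iff H by (simp add: c_def)
    ultimately show "x \<in> ?Q \<inter> ?R"
      using x unfolding Q Int_iff Q_iff by blast
  qed
  have pin: "p \<in> ?H \<inter> ?B"
    unfolding Int_iff H using h by (auto simp: mem_box_cart p_def c_def)
  have "aff_dim (?H \<inter> ?B) = aff_dim ?H"
    by (rule aff_dim_convex_Int_open) (use pin in \<open>auto simp: convex_hyperplane\<close>)
  moreover have "aff_dim ?H = int CARD('n) - 1"
    by (subst aff_dim_hyperplane) (auto simp: axis_eq_0_iff)
  moreover have "aff_dim (?Q \<inter> ?R) \<le> aff_dim ?H"
    unfolding Q by (intro aff_dim_subset) auto
  moreover have "aff_dim (?H \<inter> ?B) \<le> aff_dim (?Q \<inter> ?R)"
    by (rule aff_dim_subset[OF sub])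
  ultimately have dim: "aff_dim (?Q \<inter> ?R) = int CARD('n) - 1"
    by linarith
  have full: "aff_dim (cube z h) = int CARD('n)" for z :: "real ^ 'n"
  proof -
    have "interior (cube z h) \<noteq> {}"
      using h by (auto simp: cube_def interior_cbox interval_ne_empty_cart)
    then show ?thesis
      by (simp add: aff_dim_nonempty_interior)
  qed
  have cl: "closure (cube z h) = cube z h" for z :: "real ^ 'n"
    by (simp add: cube_def)
  have ne: "?Q \<inter> ?R \<noteq> {}"
    using pin sub by blast
  show ?thesis
    unfolding consecutive_def cl facet_of_def using face face' ne dim full by auto
qed

text \<open>Turns the limit of suprema into a bound for individual pairs. Only translates along one
  axis are kept, since chains of them reach every cell of a grid.\<close>

lemma smooth_setD:
  fixes A :: "(real ^ 'n) set"
  assumes "smooth_set A" and "0 < e"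
  obtains d where "0 < d" and
    "\<And>y h i. 0 < h \<Longrightarrow> h \<le> d \<Longrightarrow>
      \<bar>set_density A (cube (y + axis i h) h) - set_density A (cube y h)\<bar> \<le> e"
proof -
  have A: "A \<in> sets lebesgue"
    using assms by (simp add: smooth_set_def)
  let ?S = "\<lambda>\<delta>. {\<bar>set_density A (cube x h) - set_density A (cube y h)\<bar> | x y h.
                0 < h \<and> h \<le> \<delta> \<and> consecutive (cube x h) (cube y h)}"
  have "((\<lambda>\<delta>. Sup (?S \<delta>)) \<longlongrightarrow> 0) (at_right 0)"
    using assms by (simp add: smooth_set_def)
  then have "eventually (\<lambda>\<delta>. Sup (?S \<delta>) < e) (at_right 0)"
    using \<open>0 < e\<close> by (rule order_tendstoD)
  then obtain b where b: "b > 0" "\<And>d. 0 < d \<Longrightarrow> d < b \<Longrightarrow> Sup (?S d) < e"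
    unfolding eventually_at_right_field by auto
  \<comment> \<open>On the reals \<open>Sup\<close> dominates the elements only of a set that is
    bounded above; here the densities lie in \<open>{0..1}\<close>.\<close>
  have bdd: "bdd_above (?S d)" for d
  proof (rule bdd_aboveI[of _ 1])
    fix v assume "v \<in> ?S d"
    then obtain x y h where v: "v = \<bar>set_density A (cube x h) - set_density A (cube y h)\<bar>"
      by auto
    show "v \<le> 1"
      unfolding v using set_density_bounds[OF A, of x h] set_density_bounds[OF A, of y h] by linarith
  qed
  show thesis
  proof
    show "0 < b / 2"
      using b by simp
    fix y :: "real ^ 'n" and h i assume h: "0 < h" "h \<le> b / 2"
    have "\<bar>set_density A (cube y h) - set_density A (cube (y + axis i h) h)\<bar> \<in> ?S (b / 2)"
      using consecutive_axis[OF h(1), of y i] h by blast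
    then have "\<bar>set_density A (cube y h) - set_density A (cube (y + axis i h) h)\<bar> \<le> Sup (?S (b / 2))"
      by (rule cSup_upper[OF _ bdd])
    then show "\<bar>set_density A (cube (y + axis i h) h) - set_density A (cube y h)\<bar> \<le> e"
      using b(2)[of "b / 2"] b(1) by (simp add: abs_minus_commute)
  qed
qed

text \<open>Walk from \<open>k\<close> to \<open>k'\<close> by unit coordinate steps, each of which
  shortens the l1 distance by one. With \<open>w = 0\<close> this expresses that the lattice is
  connected, which later yields neighbouring cubes whose densities lie on different sides of
  \<alpha>.\<close>

lemma lattice_lipschitz:
  fixes f :: "int ^ 'n \<Rightarrow> real"
  assumes step: "\<And>k i. \<bar>f (k + axis i 1) - f k\<bar> \<le> w"
  shows "\<bar>f k - f k'\<bar> \<le> w * real_of_int (\<Sum>i\<in>UNIV. \<bar>k $ i - k' $ i\<bar>)"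
proof (induction "nat (\<Sum>i\<in>UNIV. \<bar>k $ i - k' $ i\<bar>)" arbitrary: k)
  case 0
  then have "(\<Sum>i\<in>UNIV. \<bar>k $ i - k' $ i\<bar>) = 0"
    by (simp add: sum_nonneg order_antisym)
  then have "\<forall>i. k $ i = k' $ i"
    by (subst (asm) sum_nonneg_eq_0_iff) auto
  then have "k = k'"
    by (simp add: vec_eq_iff)
  then show ?case
    by simp
next
  case (Suc N)
  let ?s = "\<lambda>k. \<Sum>i\<in>UNIV. \<bar>k $ i - k' $ i\<bar>"
  have "?s k \<noteq> 0"
    using Suc by auto
  then obtain i where i: "k $ i \<noteq> k' $ i"
    by (metis (no_types, lifting) abs_zero cancel_comm_monoid_add_class.diff_cancel sum.neutral)
  define e :: int where "e = (if k $ i < k' $ i then 1 else -1)"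
  define k2 where "k2 = k + axis i e"
  have sk2: "?s k2 = ?s k - 1"
  proof -
    have "?s k2 = \<bar>k2 $ i - k' $ i\<bar> + (\<Sum>j\<in>UNIV - {i}. \<bar>k2 $ j - k' $ j\<bar>)"
      by (simp add: sum.remove[of UNIV i])
    also have "(\<Sum>j\<in>UNIV - {i}. \<bar>k2 $ j - k' $ j\<bar>) = (\<Sum>j\<in>UNIV - {i}. \<bar>k $ j - k' $ j\<bar>)"
      by (intro sum.cong) (auto simp: k2_def axis_def)
    also have "\<bar>k2 $ i - k' $ i\<bar> = \<bar>k $ i - k' $ i\<bar> - 1"
      using i by (auto simp: k2_def e_def axis_def)
    finally show ?thesis
      by (simp add: sum.remove[of UNIV i])
  qed
  have "N = nat (?s k2)"
    using Suc(2) sk2 by linarith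
  then have IH: "\<bar>f k2 - f k'\<bar> \<le> w * real_of_int (?s k2)"
    by (rule Suc.hyps(1))
  have "\<bar>f k2 - f k\<bar> \<le> w"
  proof (cases "k $ i < k' $ i")
    case True
    then show ?thesis
      using step[of k i] by (simp add: k2_def e_def)
  next
    case False
    then have "k = k2 + axis i 1"
      by (auto simp: k2_def e_def vec_eq_iff axis_def)
    then show ?thesis
      using step[of k2 i] by (simp add: abs_minus_commute)
  qed
  then have "\<bar>f k - f k'\<bar> \<le> w + w * real_of_int (?s k2)"
    using IH by linarith
  then show ?case
    by (simp add: sk2 algebra_simps)
qed

text \<open>Half-open grid cells of mesh \<open>t\<close> with a vertex at \<open>c\<close>: unlike closed cubes they partition
  the space exactly.\<close>

definition gix :: "real ^ 'n \<Rightarrow> real \<Rightarrow> real ^ 'n \<Rightarrow> int ^ 'n" where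
  "gix c t u = (\<chi> i. \<lfloor>(u $ i - c $ i) / t\<rfloor>)"

definition gcell :: "real ^ 'n \<Rightarrow> real \<Rightarrow> int ^ 'n \<Rightarrow> (real ^ 'n) set" where
  "gcell c t k = {u. gix c t u = k}"

definition gcen :: "real ^ 'n \<Rightarrow> real \<Rightarrow> int ^ 'n \<Rightarrow> real ^ 'n" where
  "gcen c t k = (\<chi> i. c $ i + t * (of_int (k $ i) + 1 / 2))"

lemma mem_gcell:
  assumes "0 < t"
  shows "u \<in> gcell c t k \<longleftrightarrow>
    (\<forall>i. c $ i + t * of_int (k $ i) \<le> u $ i \<and> u $ i < c $ i + t * (of_int (k $ i) + 1))"
  using assms
  by (auto simp: gcell_def gix_def vec_eq_iff floor_eq_iff field_simps)

lemma mem_gcell_gix [simp]: "u \<in> gcell c t (gix c t u)"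
  by (simp add: gcell_def)

lemma gcell_disjoint: "k \<noteq> k' \<Longrightarrow> gcell c t k \<inter> gcell c t k' = {}"
  by (auto simp: gcell_def)

lemma gcell_subset_cube:
  assumes "0 < t"
  shows "gcell c t k \<subseteq> cube (gcen c t k) t"
proof
  fix u assume "u \<in> gcell c t k"
  then show "u \<in> cube (gcen c t k) t"
    using assms by (auto simp: mem_gcell mem_cube gcen_def abs_le_iff algebra_simps less_imp_le)
     (smt (verit) field_sum_of_halves)+
qed

lemma box_subset_gcell:
  assumes "0 < t"
  shows "box (gcen c t k - vec (t / 2)) (gcen c t k + vec (t / 2)) \<subseteq> gcell c t k"
proof
  fix u assume "u \<in> box (gcen c t k - vec (t / 2)) (gcen c t k + vec (t / 2))"
  then have "c $ i + t * of_int (k $ i) < u $ i \<and> u $ i < c $ i + t * (of_int (k $ i) + 1)" for i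
    using assms by (auto simp: mem_box_cart gcen_def algebra_simps dest!: spec[of _ i])
  then show "u \<in> gcell c t k"
    using assms by (simp add: mem_gcell less_imp_le)
qed

lemma negligible_cube_minus_gcell:
  assumes "0 < t"
  shows "negligible (cube (gcen c t k) t - gcell c t k)"
  by (rule negligible_subset[OF negligible_frontier_interval])
    (use box_subset_gcell[OF assms] in \<open>auto simp: cube_def\<close>)

lemma gcell_sets [simp]:
  assumes "0 < t"
  shows "gcell c t k \<in> sets lebesgue"
proof -
  have "gcell c t k = cube (gcen c t k) t - (cube (gcen c t k) t - gcell c t k)"
    using gcell_subset_cube[OF assms] by blast
  moreover have "\<dots> \<in> sets lebesgue"
    by (intro sets.Diff cube_sets negligible_imp_sets negligible_cube_minus_gcell assms)
  ultimately show ?thesis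
    by simp
qed

lemma gcell_lmeasurable [simp]: "0 < t \<Longrightarrow> gcell c t k \<in> lmeasurable"
  by (rule fmeasurableI2[of "cube (gcen c t k) t"]) (use gcell_subset_cube in auto)

lemma measure_Int_gcell:
  assumes "0 < t" "A \<in> sets lebesgue"
  shows "measure lebesgue (A \<inter> gcell c t k) = measure lebesgue (A \<inter> cube (gcen c t k) t)"
proof (rule measure_negligible_symdiff)
  show "A \<inter> cube (gcen c t k) t \<in> lmeasurable"
    using assms by (intro fmeasurableI2[OF cube_lmeasurable[of "gcen c t k" t]]) auto
  show "negligible (sym_diff (A \<inter> cube (gcen c t k) t) (A \<inter> gcell c t k))"
    by (rule negligible_subset[OF negligible_cube_minus_gcell[OF assms(1), of c k]])
      (use gcell_subset_cube[OF assms(1), of c k] in auto)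
qed

lemma measure_gcell:
  fixes c :: "real ^ 'n"
  assumes "0 < t"
  shows "measure lebesgue (gcell c t k) = t ^ CARD('n)"
  using measure_Int_gcell[OF assms, of UNIV c k] assms by (simp add: measure_cube)

lemma measure_Int_gcell_density:
  fixes c :: "real ^ 'n"
  assumes "0 < t" "A \<in> sets lebesgue"
  shows "measure lebesgue (A \<inter> gcell c t k) = set_density A (cube (gcen c t k) t) * t ^ CARD('n)"
  using measure_Int_gcell[OF assms, of c k] assms by (simp add: set_density_def measure_cube)

lemma finite_int_vec:
  fixes a b :: "'n::finite \<Rightarrow> int"
  shows "finite {k :: int ^ 'n. \<forall>i. a i \<le> k $ i \<and> k $ i \<le> b i}"
proof -
  have "finite (PiE UNIV (\<lambda>i. {a i..b i}))"
    by (intro finite_PiE) auto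
  moreover have "{k :: int ^ 'n. \<forall>i. a i \<le> k $ i \<and> k $ i \<le> b i} \<subseteq> vec_lambda ` PiE UNIV (\<lambda>i. {a i..b i})"
    by (auto simp: image_iff intro!: bexI[of _ "vec_nth _"])
  ultimately show ?thesis
    by (meson finite_imageI finite_subset)
qed

section \<open>Comparable cubes have comparable densities\<close>

lemma gcell_dist:
  assumes "0 < t" "u \<in> gcell c t k" "v \<in> gcell c t k"
  shows "\<bar>v $ i - u $ i\<bar> \<le> t"
proof -
  have "c $ i + t * of_int (k $ i) \<le> w $ i" "w $ i < c $ i + t * of_int (k $ i) + t"
    if "w \<in> gcell c t k" for w
    using that assms(1) by (auto simp: mem_gcell algebra_simps)
  from this[OF assms(2)] this[OF assms(3)] show ?thesis
    by linarith
qed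

lemma gcen_in_gcell: "0 < t \<Longrightarrow> gcen c t k \<in> gcell c t k"
  by (simp add: mem_gcell gcen_def)

lemma finite_gcells:
  fixes c :: "real ^ 'n"
  assumes t: "0 < t" and "bounded S"
  shows "finite {k. gcell c t k \<inter> S \<noteq> {}}"
proof -
  obtain B where B: "\<And>u. u \<in> S \<Longrightarrow> norm u \<le> B"
    using assms(2) by (auto simp: bounded_iff)
  have *: "\<lfloor>(- B - c $ i) / t\<rfloor> \<le> k $ i \<and> k $ i \<le> \<lfloor>(B - c $ i) / t\<rfloor>"
    if k: "gcell c t k \<inter> S \<noteq> {}" for k i
  proof -
    obtain u where u: "u \<in> S" "gix c t u = k"
      using k unfolding gcell_def by blast
    have "\<bar>u $ i\<bar> \<le> B"
      using B[OF u(1)] component_le_norm_cart[of u i] by linarith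
    then show ?thesis
      unfolding u(2)[symmetric] gix_def using t
      by (auto intro!: floor_mono divide_right_mono)
  qed
  show ?thesis
    by (rule finite_subset[OF _ finite_int_vec[of "\<lambda>i. \<lfloor>(- B - c $ i) / t\<rfloor>" "\<lambda>i. \<lfloor>(B - c $ i) / t\<rfloor>"]])
      (use * in auto)
qed

text \<open>Cells inside the cube have densities within \<open>e\<close> of \<open>d\<close>, and
  the rest of the cube can spoil the average only by its share of the volume. That rest avoids the
  concentric cube of side \<open>H - 2 * t\<close>, so by Bernoulli's inequality its share is at
  most 2nt/H.\<close>

lemma set_density_grid:
  fixes c z :: "real ^ 'n" and t H d e :: real
  assumes A: "A \<in> sets lebesgue" and t: "0 < t" "2 * t \<le> H" and d: "0 \<le> d" "d \<le> 1" and e: "0 \<le> e"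
    and near: "\<And>k. gcen c t k \<in> cube z H \<Longrightarrow> \<bar>set_density A (cube (gcen c t k) t) - d\<bar> \<le> e"
  shows "\<bar>set_density A (cube z H) - d\<bar> \<le> e + 2 * CARD('n) * t / H"
proof -
  define P where "P = cube z H"
  define K where "K = {k. gcell c t k \<subseteq> P}"
  define W where "W = (\<Union>k\<in>K. gcell c t k)"
  have H: "0 < H"
    using t by linarith
  have bP: "bounded P"
    by (simp add: P_def cube_def)
  have "K \<subseteq> {k. gcell c t k \<inter> P \<noteq> {}}"
    using gcen_in_gcell[OF t(1), of c] by (auto simp: K_def)
  then have finK: "finite K"
    using finite_gcells[OF t(1) bP] by (rule finite_subset)
  have W: "W \<in> lmeasurable"
    unfolding W_def using t finK by (intro fmeasurable.finite_UN) auto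
  have WP: "W \<subseteq> P"
    by (auto simp: W_def K_def)
  have P: "P \<in> lmeasurable"
    by (simp add: P_def)
  have AW: "A \<inter> W \<in> lmeasurable" and AR: "A \<inter> (P - W) \<in> lmeasurable" and R: "P - W \<in> lmeasurable"
    using A W P WP by (auto intro!: fmeasurableI2[OF P])
  have sum_AW: "measure lebesgue (A \<inter> W) = (\<Sum>k\<in>K. set_density A (cube (gcen c t k) t) * t ^ CARD('n))"
  proof -
    have "measure lebesgue (A \<inter> W) = measure lebesgue (\<Union>k\<in>K. A \<inter> gcell c t k)"
      by (simp add: W_def)
    also have "\<dots> = (\<Sum>k\<in>K. measure lebesgue (A \<inter> gcell c t k))"
      using finK A t gcell_disjoint
      by (intro measure_UNION'[OF finK] fmeasurableI2[OF gcell_lmeasurable[OF t(1)]])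
         (auto simp: pairwise_def disjnt_def, blast)
    finally show ?thesis
      using t A by (simp add: measure_Int_gcell_density)
  qed
  have sum_W: "measure lebesgue W = (\<Sum>k\<in>K. t ^ CARD('n))"
  proof -
    have "measure lebesgue W = (\<Sum>k\<in>K. measure lebesgue (gcell c t k))"
      unfolding W_def using t gcell_disjoint
      by (intro measure_UNION'[OF finK]) (auto simp: pairwise_def disjnt_def, blast)
    then show ?thesis
      using t by (simp add: measure_gcell)
  qed
  have AWd: "\<bar>measure lebesgue (A \<inter> W) - d * measure lebesgue W\<bar> \<le> e * measure lebesgue W"
  proof -
    have "\<bar>measure lebesgue (A \<inter> W) - d * measure lebesgue W\<bar>
        = \<bar>\<Sum>k\<in>K. (set_density A (cube (gcen c t k) t) - d) * t ^ CARD('n)\<bar>"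
      by (simp add: sum_AW sum_W sum_subtractf sum_distrib_left algebra_simps)
    also have "\<dots> \<le> (\<Sum>k\<in>K. \<bar>(set_density A (cube (gcen c t k) t) - d) * t ^ CARD('n)\<bar>)"
      by (rule sum_abs)
    also have "\<dots> \<le> (\<Sum>k\<in>K. e * t ^ CARD('n))"
    proof (rule sum_mono)
      fix k assume "k \<in> K"
      then have "gcen c t k \<in> cube z H"
        using gcen_in_gcell[OF t(1), of c k] by (auto simp: K_def P_def)
      then show "\<bar>(set_density A (cube (gcen c t k) t) - d) * t ^ CARD('n)\<bar> \<le> e * t ^ CARD('n)"
        using near t by (auto simp: abs_mult intro!: mult_right_mono)
    qed
    also have "\<dots> = e * measure lebesgue W"
      by (simp add: sum_W sum_distrib_left)
    finally show ?thesis .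
  qed
  \<comment> \<open>A cell has width \<open>t\<close> in each coordinate, so a point at distance at
    least \<open>t\<close> from every face has its whole cell inside \<open>P\<close>.\<close>
  have sub: "cube z (H - 2 * t) \<subseteq> W"
  proof
    fix u assume u: "u \<in> cube z (H - 2 * t)"
    have "gcell c t (gix c t u) \<subseteq> P"
    proof
      fix v assume v: "v \<in> gcell c t (gix c t u)"
      have "\<bar>v $ i - z $ i\<bar> \<le> H / 2" for i
        using gcell_dist[OF t(1) mem_gcell_gix v, of i] u[unfolded mem_cube, rule_format, of i]
        unfolding diff_divide_distrib by linarith
      then show "v \<in> P"
        by (simp add: P_def mem_cube)
    qed
    then show "u \<in> W"
      by (auto simp: W_def K_def intro!: exI[of _ "gix c t u"])
  qed
  have "measure lebesgue (cube z (H - 2 * t)) \<le> measure lebesgue W"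
    by (rule measure_mono_fmeasurable[OF sub _ W]) simp
  moreover have "H ^ CARD('n) - (H - 2 * t) ^ CARD('n) \<le> 2 * CARD('n) * t / H * H ^ CARD('n)"
  proof -
    have "1 + real CARD('n) * (- (2 * t / H)) \<le> (1 + - (2 * t / H)) ^ CARD('n)"
      by (rule Bernoulli_inequality) (use t H in \<open>simp add: field_simps\<close>)
    also have "(1 + - (2 * t / H)) ^ CARD('n) * H ^ CARD('n) = (H - 2 * t) ^ CARD('n)"
      unfolding power_mult_distrib[symmetric] using H
      by (intro arg_cong[where f = "\<lambda>u. u ^ CARD('n)"]) (simp add: field_simps)
    ultimately have "(1 + real CARD('n) * (- (2 * t / H))) * H ^ CARD('n) \<le> (H - 2 * t) ^ CARD('n)"
      using H by (metis mult_right_mono less_imp_le zero_less_power)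
    then show ?thesis
      by (simp add: algebra_simps)
  qed
  moreover have mP: "measure lebesgue P = H ^ CARD('n)"
    unfolding P_def using H by (simp add: measure_cube)
  moreover have "measure lebesgue (P - W) = measure lebesgue P - measure lebesgue W"
    using measurable_measure_Diff[OF P _ WP] W by auto
  moreover have "measure lebesgue (cube z (H - 2 * t)) = (H - 2 * t) ^ CARD('n)"
    using t by (simp add: measure_cube)
  ultimately have rest: "measure lebesgue (P - W) \<le> 2 * CARD('n) * t / H * H ^ CARD('n)"
    and split: "measure lebesgue P = measure lebesgue W + measure lebesgue (P - W)"
    by linarith+
  have "measure lebesgue (A \<inter> P) = measure lebesgue (A \<inter> W \<union> A \<inter> (P - W))"
    using WP by (intro arg_cong[where f = "measure lebesgue"]) auto
  also have "\<dots> = measure lebesgue (A \<inter> W) + measure lebesgue (A \<inter> (P - W))"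
    by (rule measure_Union) (use AW AR in \<open>auto simp: fmeasurable_def\<close>)
  finally have AP: "measure lebesgue (A \<inter> P) = measure lebesgue (A \<inter> W) + measure lebesgue (A \<inter> (P - W))" .
  have "measure lebesgue (A \<inter> (P - W)) \<le> measure lebesgue (P - W)"
    by (rule measure_mono_fmeasurable) (use AR R in auto)
  moreover have "0 \<le> d * measure lebesgue (P - W)" "d * measure lebesgue (P - W) \<le> measure lebesgue (P - W)"
    using d by (auto intro: mult_left_le_one_le)
  ultimately have "\<bar>measure lebesgue (A \<inter> (P - W)) - d * measure lebesgue (P - W)\<bar> \<le> measure lebesgue (P - W)"
    using measure_nonneg[of lebesgue "A \<inter> (P - W)"] by linarith
  moreover have "d * measure lebesgue P = d * measure lebesgue W + d * measure lebesgue (P - W)"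
    by (simp add: split algebra_simps)
  moreover have "e * measure lebesgue W \<le> e * measure lebesgue P"
    using e split measure_nonneg[of lebesgue "P - W"] by (intro mult_left_mono) linarith+
  ultimately have "\<bar>measure lebesgue (A \<inter> P) - d * measure lebesgue P\<bar>
      \<le> e * measure lebesgue P + measure lebesgue (P - W)"
    using AWd AP by linarith
  also have "\<dots> \<le> e * measure lebesgue P + 2 * CARD('n) * t / H * H ^ CARD('n)"
    using rest by simp
  finally have "\<bar>measure lebesgue (A \<inter> P) - d * H ^ CARD('n)\<bar>
      \<le> e * H ^ CARD('n) + 2 * CARD('n) * t / H * H ^ CARD('n)"
    unfolding mP .
  then have "\<bar>measure lebesgue (A \<inter> P) - d * H ^ CARD('n)\<bar> / H ^ CARD('n)
      \<le> (e + 2 * CARD('n) * t / H)"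
    using H by (subst pos_divide_le_eq) (auto simp: distrib_right)
  moreover have "set_density A (cube z H) - d = (measure lebesgue (A \<inter> P) - d * H ^ CARD('n)) / H ^ CARD('n)"
    using H mP by (simp add: set_density_def P_def diff_divide_distrib)
  ultimately show ?thesis
    using H by (simp add: abs_divide)
qed

text \<open>Smoothness compares only equal cubes that share a face. Here both cubes are cut by one
  fine grid with a vertex at \<open>y\<close>, and each density is compared with \<open>f 0\<close>,
  the density in the grid cell with least vertex \<open>y\<close>. The number of steps between cells
  is bounded independently of the scale, so smoothness at the small scale suffices.\<close>

lemma smooth_set_comparable:
  fixes A :: "(real ^ 'n) set"
  assumes smooth: "smooth_set A" and e: "0 < e"
  obtains d where "0 < d" and
    "\<And>x y h l. 0 < l \<Longrightarrow> l \<le> h \<Longrightarrow> h \<le> 2 * l \<Longrightarrow> h \<le> d \<Longrightarrow> (\<And>i. \<bar>x $ i - y $ i\<bar> \<le> h) \<Longrightarrow>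
      \<bar>set_density A (cube x h) - set_density A (cube y l)\<bar> \<le> e"
proof -
  have A: "A \<in> sets lebesgue"
    using smooth by (simp add: smooth_set_def)
  obtain M :: nat where M: "8 * CARD('n) / e < M"
    using reals_Archimedean2 by blast
  have M8: "8 * CARD('n) < e * M"
    using M e by (simp add: pos_divide_less_eq mult.commute)
  \<comment> \<open>The choice of \<open>M\<close> makes the boundary error 2n/N at most e/4; the
    bound 2 leaves room for at least two cells along each side.\<close>
  define N where "N = max 2 M"
  have N: "real N \<ge> 2" "8 * CARD('n) < e * N"
    using M8 e unfolding N_def by (auto intro: less_le_trans mult_left_mono)
  \<comment> \<open>The cells in question have indices at most 5N in each coordinate, so n * 5N unit
    steps lead to any of them, at a total cost of e/4.\<close>
  define w where "w = e / (4 * (CARD('n) * (5 * N)))"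
  have w: "0 < w"
    using e N by (simp add: w_def)
  obtain d where d: "0 < d" and
    adj: "\<And>y h i. 0 < h \<Longrightarrow> h \<le> d \<Longrightarrow>
      \<bar>set_density A (cube (y + axis i h) h) - set_density A (cube y h)\<bar> \<le> w"
    using smooth_setD[OF smooth w] by blast
  show thesis
  proof
    show "0 < d"
      by fact
    fix x y :: "real ^ 'n" and h l :: real
    assume l: "0 < l" "l \<le> h" "h \<le> 2 * l" "h \<le> d" and xy: "\<And>i. \<bar>x $ i - y $ i\<bar> \<le> h"
    define t where "t = l / N"
    have t0: "0 < t" and lt: "l = N * t"
      using l N by (auto simp: t_def)
    then have "2 * t \<le> l"
      using N mult_right_mono[of 2 "real N" t] by simp
    with t0 lt l have t: "0 < t" "2 * t \<le> l" "t \<le> d" "l = N * t"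
      by linarith+
    define f where "f = (\<lambda>k. set_density A (cube (gcen y t k) t))"
    have step: "\<bar>f (k + axis i 1) - f k\<bar> \<le> w" for k i
    proof -
      have "gcen y t (k + axis i 1) = gcen y t k + axis i t"
        by (simp add: gcen_def vec_eq_iff axis_def algebra_simps)
      then show ?thesis
        using adj[OF t(1,3), of "gcen y t k" i] by (simp add: f_def)
    qed
    \<comment> \<open>The radius \<open>4 * l\<close> leaves room: the cubes to be compared have
      half-side at most \<open>l\<close> and centre within \<open>2 * l\<close> of
      \<open>y\<close>.\<close>
    have near: "\<bar>f k - f 0\<bar> \<le> e / 4" if k: "\<And>i. \<bar>gcen y t k $ i - y $ i\<bar> \<le> 4 * l" for k
    proof -
      have ki: "\<bar>k $ i\<bar> \<le> 5 * int N" for i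
      proof -
        have "\<bar>t * (real_of_int (k $ i) + 1 / 2)\<bar> \<le> 4 * (N * t)"
          using k[of i] t by (simp add: gcen_def)
        then have "\<bar>real_of_int (k $ i) + 1 / 2\<bar> * t \<le> (4 * N) * t"
          using t by (simp add: abs_mult mult.commute)
        then have "\<bar>real_of_int (k $ i) + 1 / 2\<bar> \<le> 4 * N"
          using t by (simp only: mult_le_cancel_right_pos)
        then have "\<bar>real_of_int (k $ i)\<bar> \<le> 5 * N"
          using N by linarith
        then show ?thesis
          by linarith
      qed
      have "\<bar>f k - f 0\<bar> \<le> w * real_of_int (\<Sum>i\<in>UNIV. \<bar>k $ i - (0 :: int ^ 'n) $ i\<bar>)"
        by (rule lattice_lipschitz[OF step])
      also have "\<dots> \<le> w * real_of_int (\<Sum>i\<in>(UNIV :: 'n set). 5 * int N)"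
        using w ki by (intro mult_left_mono iffD2[OF of_int_le_iff] sum_mono) auto
      also have "\<dots> = e / 4"
        using N by (simp add: w_def field_simps)
      finally show ?thesis .
    qed
    have f0: "0 \<le> f 0" "f 0 \<le> 1"
      using set_density_bounds[OF A] by (auto simp: f_def)
    have approx: "\<bar>set_density A (cube z H) - f 0\<bar> \<le> e / 2"
      if H: "l \<le> H" "H \<le> 2 * l" and z: "\<And>i. \<bar>z $ i - y $ i\<bar> \<le> 2 * l" for z H
    proof -
      have "\<bar>set_density A (cube z H) - f 0\<bar> \<le> e / 4 + 2 * CARD('n) * t / H"
      proof (rule set_density_grid[OF A t(1)])
        show "2 * t \<le> H"
          using t H by linarith
        fix k assume k: "gcen y t k \<in> cube z H"
        have "\<bar>gcen y t k $ i - y $ i\<bar> \<le> 4 * l" for i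
          using k[unfolded mem_cube, rule_format, of i] z[of i] H l by linarith
        then show "\<bar>set_density A (cube (gcen y t k) t) - f 0\<bar> \<le> e / 4"
          using near unfolding f_def by blast
      qed (use f0 e in auto)
      also have "2 * CARD('n) * t / H \<le> 2 * CARD('n) * t / l"
        using H(1) l(1) t(1) by (intro divide_left_mono mult_pos_pos) auto
      also have "\<dots> = 2 * CARD('n) / N"
        using t l N by simp
      also have "\<dots> \<le> e / 4"
        using N by (simp add: field_simps)
      finally show ?thesis
        by simp
    qed
    have "\<bar>set_density A (cube x h) - f 0\<bar> \<le> e / 2"
      by (rule approx) (use l xy in \<open>auto intro: order_trans[OF xy]\<close>)
    moreover have "\<bar>set_density A (cube y l) - f 0\<bar> \<le> e / 2"
      by (rule approx) (use l in auto)
    ultimately show "\<bar>set_density A (cube x h) - set_density A (cube y l)\<bar> \<le> e"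
      by linarith
  qed
qed

text \<open>Collects all comparisons below a given scale in one monotone sequence. The bound
  \<open>2 / 2 ^ m\<close>, twice the side of a cube of level \<open>m\<close>, lets
  \<open>w m\<close> compare such a cube with its dyadic parent.\<close>

lemma smooth_set_modulus:
  fixes A :: "(real ^ 'n) set"
  assumes smooth: "smooth_set A"
  obtains w :: "nat \<Rightarrow> real" where "antimono w" "\<And>m. 0 < w m" "w \<longlonglongrightarrow> 0"
    "\<And>m x y h l. 0 < l \<Longrightarrow> l \<le> h \<Longrightarrow> h \<le> 2 * l \<Longrightarrow> h \<le> 2 / 2 ^ m \<Longrightarrow> (\<And>i. \<bar>x $ i - y $ i\<bar> \<le> h) \<Longrightarrow>
      \<bar>set_density A (cube x h) - set_density A (cube y l)\<bar> \<le> w m"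
proof -
  have A: "A \<in> sets lebesgue"
    using smooth by (simp add: smooth_set_def)
  define S where "S = (\<lambda>m. {\<bar>set_density A (cube x h) - set_density A (cube y l)\<bar> | x y h l.
     0 < l \<and> l \<le> h \<and> h \<le> 2 * l \<and> h \<le> 2 / 2 ^ m \<and> (\<forall>i. \<bar>x $ i - y $ i\<bar> \<le> h)})"
  have bdd: "bdd_above (S m)" for m
  proof (rule bdd_aboveI[of _ 1])
    fix v assume "v \<in> S m"
    then obtain x y h l where v: "v = \<bar>set_density A (cube x h) - set_density A (cube y l)\<bar>"
      by (auto simp: S_def)
    show "v \<le> 1"
      unfolding v using set_density_bounds[OF A, of x h] set_density_bounds[OF A, of y l] by linarith
  qed
  have zero: "0 \<in> S m" for m
  proof -
    have "\<bar>set_density A (cube 0 (1 / 2 ^ m)) - set_density A (cube 0 (1 / 2 ^ m))\<bar> \<in> S m"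
      unfolding S_def by (rule CollectI) (intro exI conjI, rule refl, auto simp: field_simps)
    then show ?thesis
      by simp
  qed
  have S_mono: "S n \<subseteq> S m" if "m \<le> n" for m n
  proof -
    have "2 / 2 ^ n \<le> (2 :: real) / 2 ^ m"
      using that by (intro divide_left_mono power_increasing) auto
    then show ?thesis
      unfolding S_def using order_trans by blast
  qed
  \<comment> \<open>The added null sequence makes \<open>w\<close> strictly positive, so that
    inequalities may later be divided by it.\<close>
  define w where "w = (\<lambda>m. Sup (S m) + inverse (real (Suc m)))"
  have Sup0: "0 \<le> Sup (S m)" for m
    by (rule cSup_upper[OF zero bdd])
  show thesis
  proof
    show "antimono w"
    proof
      fix m n :: nat assume mn: "m \<le> n"
      have "Sup (S n) \<le> Sup (S m)"
        using zero[of n] by (intro cSup_subset_mono bdd S_mono mn) auto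
      then show "w n \<le> w m"
        unfolding w_def using mn by (intro add_mono le_imp_inverse_le) auto
    qed
    show "0 < w m" for m
      using Sup0[of m] unfolding w_def by (intro add_nonneg_pos) auto
    have "(\<lambda>m. Sup (S m)) \<longlonglongrightarrow> 0"
    proof (rule LIMSEQ_I)
      fix r :: real assume r: "0 < r"
      obtain d where d: "0 < d" and
        comp: "\<And>x y h l. 0 < l \<Longrightarrow> l \<le> h \<Longrightarrow> h \<le> 2 * l \<Longrightarrow> h \<le> d \<Longrightarrow> (\<And>i. \<bar>x $ i - y $ i\<bar> \<le> h) \<Longrightarrow>
          \<bar>set_density A (cube x h) - set_density A (cube y l)\<bar> \<le> r / 2"
        using smooth_set_comparable[OF smooth, of "r / 2"] r by (metis half_gt_zero)
      obtain m0 where m0: "(1 / 2) ^ m0 < d / 2"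
        using real_arch_pow_inv[of "d / 2" "1 / 2"] d by auto
      have "norm (Sup (S m) - 0) < r" if "m \<ge> m0" for m
      proof -
        have "(2 :: real) / 2 ^ m \<le> 2 / 2 ^ m0"
          using that by (intro divide_left_mono power_increasing) auto
        also have "\<dots> \<le> d"
          using m0 by (simp add: power_one_over field_simps)
        finally have "2 / 2 ^ m \<le> d" .
        have "v \<le> r / 2" if "v \<in> S m" for v
        proof -
          obtain x y :: "real ^ 'n" and h l where v: "v = \<bar>set_density A (cube x h) - set_density A (cube y l)\<bar>"
            and *: "0 < l" "l \<le> h" "h \<le> 2 * l" "h \<le> 2 / 2 ^ m" "\<And>i. \<bar>x $ i - y $ i\<bar> \<le> h"
            using \<open>v \<in> S m\<close> unfolding S_def by blast
          have "h \<le> d"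
            using *(4) \<open>2 / 2 ^ m \<le> d\<close> by linarith
          from comp[OF *(1-3) this *(5)] show ?thesis
            by (simp add: v)
        qed
        then have "Sup (S m) \<le> r / 2"
          using zero[of m] by (intro cSup_least) auto
        then show ?thesis
          using Sup0[of m] r by simp
      qed
      then show "\<exists>no. \<forall>n\<ge>no. norm (Sup (S n) - 0) < r"
        by blast
    qed
    then show "w \<longlonglongrightarrow> 0"
      unfolding w_def using tendsto_add[OF _ LIMSEQ_inverse_real_of_nat] by fastforce
    fix m and x y :: "real ^ 'n" and h l :: real
    assume "0 < l" "l \<le> h" "h \<le> 2 * l" "h \<le> 2 / 2 ^ m" "\<And>i. \<bar>x $ i - y $ i\<bar> \<le> h"
    then have "\<bar>set_density A (cube x h) - set_density A (cube y l)\<bar> \<in> S m"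
      unfolding S_def by blast
    then have "\<bar>set_density A (cube x h) - set_density A (cube y l)\<bar> \<le> Sup (S m)"
      by (rule cSup_upper[OF _ bdd])
    also have "\<dots> \<le> w m"
      by (simp add: w_def)
    finally show "\<bar>set_density A (cube x h) - set_density A (cube y l)\<bar> \<le> w m" .
  qed
qed

section \<open>Dyadic cubes and stopping\<close>

text \<open>The pair \<open>(m, k)\<close> stands for the dyadic cube of side \<open>2^-m\<close> whose least vertex is \<open>2^-m k\<close>.\<close>

type_synonym 'n dyadic = "nat \<times> (int, 'n) vec"

definition dyad :: "nat \<Rightarrow> real ^ 'n \<Rightarrow> 'n dyadic" where
  "dyad m u = (m, gix 0 (1 / 2 ^ m) u)"

definition side :: "'n dyadic \<Rightarrow> real" where
  "side p = 1 / 2 ^ fst p"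

definition centre :: "'n dyadic \<Rightarrow> real ^ 'n" where
  "centre p = gcen 0 (side p) (snd p)"

text \<open>Two versions of the cube are needed: the half-open one so that measures add up exactly,
  and the closed one \<open>ccell\<close> for densities and for the compactness of nested
  intersections.\<close>

definition cell :: "'n::finite dyadic \<Rightarrow> (real ^ 'n) set" where
  "cell p = gcell 0 (side p) (snd p)"

definition ccell :: "'n::finite dyadic \<Rightarrow> (real ^ 'n) set" where
  "ccell p = cube (centre p) (side p)"

definition dens :: "(real ^ 'n) set \<Rightarrow> 'n dyadic \<Rightarrow> real" where
  "dens A p = set_density A (ccell p)"

lemma side_pos [simp]: "0 < side p" "0 \<le> side p" "side p \<noteq> 0"
  by (auto simp: side_def)

lemma fst_dyad [simp]: "fst (dyad m u) = m"
  by (simp add: dyad_def)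

lemma mem_cell: "u \<in> cell p \<longleftrightarrow> dyad (fst p) u = p"
  by (cases p) (auto simp: cell_def dyad_def gcell_def side_def)

lemma mem_cell_dyad [simp]: "u \<in> cell (dyad m u)"
  by (simp add: mem_cell)

lemma centre_in_cell: "centre p \<in> cell p"
  unfolding centre_def cell_def by (rule gcen_in_gcell) simp

text \<open>The coarser index is determined by the finer one, through integer division of each
  coordinate by \<open>2 ^ (j - i)\<close>.\<close>

lemma dyad_coarser:
  assumes "dyad j u = dyad j v" "i \<le> j"
  shows "dyad i u = dyad i v"
proof -
  have "\<lfloor>2 ^ i * x\<rfloor> = \<lfloor>2 ^ j * x\<rfloor> div 2 ^ (j - i)" for x :: real
  proof -
    have "(2 :: real) ^ j = 2 ^ i * 2 ^ (j - i)"
      using assms(2) by (simp flip: power_add)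
    then have "2 ^ i * x = (2 ^ j * x) / real_of_int (2 ^ (j - i))"
      by simp
    then show ?thesis
      by (simp only: floor_divide_real_eq_div zero_le_power zero_le_numeral)
  qed
  then have "dyad i x = (i, \<chi> l. snd (dyad j x) $ l div 2 ^ (j - i))" for x :: "real ^ 'a"
    by (simp add: dyad_def gix_def vec_eq_iff mult.commute)
  then show ?thesis
    using assms(1) by simp
qed

lemma cell_dyad_subset:
  assumes "u \<in> cell p" "fst p \<le> m"
  shows "cell (dyad m u) \<subseteq> cell p"
proof
  fix v assume "v \<in> cell (dyad m u)"
  then have "dyad (fst p) v = dyad (fst p) u"
    using dyad_coarser[of m v u] assms(2) by (simp add: mem_cell)
  then show "v \<in> cell p"
    using assms(1) by (simp add: mem_cell)
qed

lemma cell_subset_dyad: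
  assumes "u \<in> cell q" "m \<le> fst q"
  shows "cell q \<subseteq> cell (dyad m u)"
proof
  fix v assume "v \<in> cell q"
  then have "dyad (fst q) v = dyad (fst q) u"
    using assms(1) by (simp add: mem_cell)
  then show "v \<in> cell (dyad m u)"
    using dyad_coarser[of "fst q" v u m] assms(2) by (simp add: mem_cell)
qed

lemma cell_subset_ccell: "cell p \<subseteq> ccell p"
  unfolding cell_def ccell_def centre_def by (rule gcell_subset_cube) simp

text \<open>Lets inclusions between half-open cells pass to the closed cubes.\<close>

lemma ccell_eq_closure: "ccell p = closure (cell p)"
proof (rule antisym)
  let ?B = "box (centre p - vec (side p / 2)) (centre p + vec (side p / 2))"
  have "centre p \<in> ?B"
    by (simp add: mem_box_cart)
  then have "?B \<noteq> {}"
    by blast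
  then have "ccell p = closure ?B"
    by (simp add: ccell_def cube_def closure_box)
  moreover have "?B \<subseteq> cell p"
    unfolding centre_def cell_def by (rule box_subset_gcell) simp
  ultimately show "ccell p \<subseteq> closure (cell p)"
    by (simp add: closure_mono)
  show "closure (cell p) \<subseteq> ccell p"
    unfolding ccell_def cube_def
    by (intro closure_minimal closed_cbox) (use cell_subset_ccell[of p] in \<open>simp add: ccell_def cube_def\<close>)
qed

lemma ccell_mono: "cell q \<subseteq> cell p \<Longrightarrow> ccell q \<subseteq> ccell p"
  by (simp add: ccell_eq_closure closure_mono)

lemma cell_sets [simp]: "cell p \<in> sets lebesgue" and cell_lmeasurable [simp]: "cell p \<in> lmeasurable"
  by (auto simp: cell_def)

lemma bounded_cell: "bounded (cell p)"
  by (rule bounded_subset[OF _ cell_subset_ccell]) (simp add: ccell_def cube_def)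

lemma measure_cell: "measure lebesgue (cell (p :: 'n::finite dyadic)) = side p ^ CARD('n)"
  by (simp add: cell_def measure_gcell)

lemma measure_Int_cell:
  "A \<in> sets lebesgue \<Longrightarrow> measure lebesgue (A \<inter> cell p) = dens A p * measure lebesgue (cell p)"
  unfolding measure_cell by (simp add: cell_def dens_def ccell_def centre_def measure_Int_gcell_density)

lemma dens_bounds: "A \<in> sets lebesgue \<Longrightarrow> 0 \<le> dens A p" "A \<in> sets lebesgue \<Longrightarrow> dens A p \<le> 1"
  by (simp_all add: dens_def ccell_def set_density_bounds)

lemma dens_compl:
  assumes "A \<in> sets lebesgue"
  shows "dens (- A) p = 1 - dens A p"
proof -
  have "measure lebesgue (- A \<inter> cell p) = measure lebesgue (cell p - A \<inter> cell p)"
    by (rule arg_cong[where f = "measure lebesgue"]) auto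
  also have "\<dots> = measure lebesgue (cell p) - measure lebesgue (A \<inter> cell p)"
    by (rule measurable_measure_Diff) (use assms in auto)
  finally have "dens (- A) p * measure lebesgue (cell p) = (1 - dens A p) * measure lebesgue (cell p)"
    using assms measure_Int_cell[of "- A" p]
    by (simp add: measure_Int_cell Compl_in_sets_lebesgue algebra_simps)
  then show ?thesis
    by (simp add: measure_cell)
qed

section \<open>Finite families of stopped cubes\<close>

lemma finite_cells:
  assumes "bounded S"
  shows "finite {q :: 'n::finite dyadic. fst q \<le> M \<and> cell q \<inter> S \<noteq> {}}"
proof (rule finite_subset)
  show "{q :: 'n::finite dyadic. fst q \<le> M \<and> cell q \<inter> S \<noteq> {}}
      \<subseteq> (SIGMA m:{..M}. {k. gcell 0 (1 / 2 ^ m) k \<inter> S \<noteq> {}})"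
    by (auto simp: cell_def side_def)
  show "finite (SIGMA m:{..M}. {k :: int ^ 'n. gcell 0 (1 / 2 ^ m) k \<inter> S \<noteq> {}})"
    using assms by (intro finite_SigmaI finite_gcells) auto
qed

lemma dyad_pred_sets: "{u :: real ^ 'n. P (dyad j u)} \<in> sets lebesgue"
proof -
  have "{u :: real ^ 'n. P (dyad j u)} = (\<Union>q\<in>{q. fst q = j \<and> P q}. cell q)"
    by (auto simp: mem_cell)
  also have "\<dots> \<in> sets lebesgue"
    by (intro sets.countable_UN'') auto
  finally show ?thesis .
qed

text \<open>A stopping time written as a family of cubes: starting from \<open>p\<close> itself,
  each point is stopped at the first level at which its dyadic cube satisfies \<open>S\<close>. The
  cutoff \<open>M\<close> keeps the family finite, so that sums replace integrals.\<close>

definition first_cells :: "'n::finite dyadic \<Rightarrow> ('n dyadic \<Rightarrow> bool) \<Rightarrow> nat \<Rightarrow> 'n dyadic set" where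
  "first_cells p S M = {q. fst p \<le> fst q \<and> fst q \<le> M \<and> cell q \<subseteq> cell p \<and> S q \<and>
     (\<forall>u\<in>cell q. \<forall>j. fst p \<le> j \<and> j < fst q \<longrightarrow> \<not> S (dyad j u))}"

lemma finite_first_cells: "finite (first_cells p S M)"
proof (rule finite_subset[OF _ finite_cells[OF bounded_cell[of p], of M]])
  show "first_cells p S M \<subseteq> {q. fst q \<le> M \<and> cell q \<inter> cell p \<noteq> {}}"
    unfolding first_cells_def using centre_in_cell by blast
qed

lemma disjoint_first_cells: "pairwise (\<lambda>q r. disjnt (cell q) (cell r)) (first_cells p S M)"
proof -
  have *: "fst r \<le> fst q"
    if "q \<in> first_cells p S M" "r \<in> first_cells p S M" "u \<in> cell q" "u \<in> cell r" for q r u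
  proof (rule ccontr)
    assume "\<not> fst r \<le> fst q"
    then have "\<not> S (dyad (fst q) u)"
      using that by (auto simp: first_cells_def)
    then show False
      using that by (auto simp: first_cells_def mem_cell)
  qed
  show ?thesis
    unfolding pairwise_def disjnt_iff
  proof (intro ballI impI allI notI, elim conjE)
    fix q r u assume qr: "q \<in> first_cells p S M" "r \<in> first_cells p S M" "q \<noteq> r"
      and u: "u \<in> cell q" "u \<in> cell r"
    have "fst q = fst r"
      using *[OF qr(1,2) u] *[OF qr(2,1) u(2) u(1)] by simp
    then show False
      using u qr(3) by (metis mem_cell)
  qed
qed

lemma Union_first_cells:
  "(\<Union>q\<in>first_cells p S M. cell q) = {u \<in> cell p. \<exists>j. fst p \<le> j \<and> j \<le> M \<and> S (dyad j u)}"
proof (intro antisym subsetI)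
  fix u assume "u \<in> (\<Union>q\<in>first_cells p S M. cell q)"
  then obtain q where q: "q \<in> first_cells p S M" "u \<in> cell q"
    by blast
  then have "dyad (fst q) u = q"
    by (simp add: mem_cell)
  with q show "u \<in> {u \<in> cell p. \<exists>j. fst p \<le> j \<and> j \<le> M \<and> S (dyad j u)}"
    unfolding first_cells_def by fastforce
next
  fix u assume u: "u \<in> {u \<in> cell p. \<exists>j. fst p \<le> j \<and> j \<le> M \<and> S (dyad j u)}"
  define j where "j = (LEAST j. fst p \<le> j \<and> j \<le> M \<and> S (dyad j u))"
  have j: "fst p \<le> j" "j \<le> M" "S (dyad j u)"
    using u LeastI_ex[of "\<lambda>j. fst p \<le> j \<and> j \<le> M \<and> S (dyad j u)"] unfolding j_def by auto
  have "\<not> S (dyad i v)" if "v \<in> cell (dyad j u)" "fst p \<le> i" "i < j" for i v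
  proof -
    have "dyad i v = dyad i u"
      using that dyad_coarser[of j v u i] by (simp add: mem_cell)
    moreover have "\<not> (fst p \<le> i \<and> i \<le> M \<and> S (dyad i u))"
      using that(3) unfolding j_def by (rule not_less_Least)
    ultimately show ?thesis
      using that j by auto
  qed
  then have "dyad j u \<in> first_cells p S M"
    using j u cell_dyad_subset[of u p j] by (auto simp: first_cells_def)
  then show "u \<in> (\<Union>q\<in>first_cells p S M. cell q)"
    by (rule UN_I) simp
qed

text \<open>The points not yet stopped by level \<open>M\<close> form decreasing sets whose
  intersection is null, so continuity of the measure from above allows a finite cutoff with
  arbitrarily small loss.\<close>

lemma first_cells_exhaust:
  fixes T :: "(real ^ 'n) set"
  assumes T: "T \<in> lmeasurable" "T \<subseteq> cell p"
    and null: "negligible {u \<in> T. \<forall>j\<ge>fst p. \<not> S (dyad j u)}" and e: "0 < e"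
  obtains M where "measure lebesgue (T - (\<Union>q\<in>first_cells p S M. cell q)) < e"
proof -
  define R where "R = (\<lambda>M. T - (\<Union>q\<in>first_cells p S M. cell q))"
  have R: "R M \<in> sets lebesgue" for M
    unfolding R_def by (intro sets.Diff fmeasurableD[OF T(1)] sets.finite_UN finite_first_cells cell_sets)
  have "(\<lambda>M. measure lebesgue (R M)) \<longlonglongrightarrow> measure lebesgue (\<Inter>M. R M)"
  proof (rule Lim_measure_decseq)
    show "range R \<subseteq> sets lebesgue"
      using R by auto
    show "decseq R"
      unfolding R_def Union_first_cells by (auto simp: decseq_def intro: order_trans)
    show "emeasure lebesgue (R i) \<noteq> \<infinity>" for i
    proof -
      have "R i \<in> lmeasurable"
        by (rule fmeasurableI2[OF T(1) _ R]) (auto simp: R_def)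
      then show ?thesis
        by (auto simp: fmeasurable_def)
    qed
  qed
  moreover have "(\<Inter>M. R M) \<subseteq> {u \<in> T. \<forall>j\<ge>fst p. \<not> S (dyad j u)}"
    using T(2) unfolding R_def Union_first_cells by auto
  then have "negligible (\<Inter>M. R M)"
    using null negligible_subset by blast
  then have "measure lebesgue (\<Inter>M. R M) = 0"
    by (rule negligible_imp_measure0)
  ultimately have "(\<lambda>M. measure lebesgue (R M)) \<longlonglongrightarrow> 0"
    by simp
  then have "eventually (\<lambda>M. measure lebesgue (R M) < e) sequentially"
    using e by (rule order_tendstoD)
  then show thesis
    using that unfolding R_def eventually_sequentially by blast
qed

lemma measure_Int_UN_cells:
  assumes "finite F" "pairwise (\<lambda>q r. disjnt (cell q) (cell r)) F" "A \<in> sets lebesgue"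
  shows "measure lebesgue (A \<inter> (\<Union>q\<in>F. cell q)) = (\<Sum>q\<in>F. dens A q * measure lebesgue (cell q))"
proof -
  have "A \<inter> (\<Union>q\<in>F. cell q) = (\<Union>q\<in>F. A \<inter> cell q)"
    by auto
  moreover have "measure lebesgue (\<Union>q\<in>F. A \<inter> cell q) = (\<Sum>q\<in>F. measure lebesgue (A \<inter> cell q))"
  proof (rule measure_UNION'[OF assms(1)])
    show "pairwise (\<lambda>q r. disjnt (A \<inter> cell q) (A \<inter> cell r)) F"
      using assms(2) unfolding pairwise_def disjnt_def by blast
    show "A \<inter> cell q \<in> lmeasurable" for q
      using assms(3) by (intro fmeasurableI2[OF cell_lmeasurable[of q]]) auto
  qed
  ultimately show ?thesis
    using assms by (simp add: measure_Int_cell)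
qed

lemma measure_UN_cells:
  assumes "finite F" "pairwise (\<lambda>q r. disjnt (cell q) (cell r)) F"
  shows "measure lebesgue (\<Union>q\<in>F. cell q) = (\<Sum>q\<in>F. measure lebesgue (cell q))"
  by (rule measure_UNION'[OF assms(1) _ assms(2)]) simp

section \<open>Density theorem and optional stopping\<close>

lemma dyad_eventually_subset:
  fixes u :: "real ^ 'n"
  assumes "open U" "u \<in> U"
  obtains j where "m \<le> j" "cell (dyad j u) \<subseteq> U"
proof -
  obtain e where e: "0 < e" "ball u e \<subseteq> U"
    using assms by (meson openE)
  have "0 < e / CARD('n)"
    using e by simp
  then obtain j0 where j0: "(1 / 2) ^ j0 < e / CARD('n)"
    using real_arch_pow_inv[of "e / CARD('n)" "1 / 2"] by auto
  define j where "j = max m j0"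
  have "(1 / 2 :: real) ^ j \<le> (1 / 2) ^ j0"
    unfolding j_def by (intro power_decreasing) auto
  then have j: "(1 / 2) ^ j < e / CARD('n)"
    using j0 by linarith
  have "cell (dyad j u) \<subseteq> ball u e"
  proof
    fix v assume v: "v \<in> cell (dyad j u)"
    have "\<bar>v $ i - u $ i\<bar> \<le> (1 / 2) ^ j" for i
      using gcell_dist[of "side (dyad j u)" u 0 "snd (dyad j u)" v i] v mem_cell_dyad[of u j]
      unfolding cell_def by (simp add: side_def power_one_over)
    then have "norm (v - u) \<le> (\<Sum>i\<in>(UNIV :: 'n set). (1 / 2) ^ j)"
      by (intro order_trans[OF norm_le_l1_cart] sum_mono) simp
    also have "\<dots> < e"
      using j by (simp add: field_simps)
    finally show "v \<in> ball u e"
      by (simp add: dist_norm norm_minus_commute)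
  qed
  then show thesis
    using that[of j] e(2) by (auto simp: j_def)
qed

text \<open>A substitute for the Lebesgue density theorem. If \<open>T\<close> had positive measure, an open superset
  \<open>U\<close> of nearly the same measure would be almost exhausted by dyadic cubes meeting \<open>T\<close>, in each of
  which \<open>T\<close> fills at most the proportion \<open>b < 1\<close>.\<close>

lemma negligible_low_density:
  fixes A :: "(real ^ 'n) set"
  assumes A: "A \<in> sets lebesgue" and T: "T \<in> sets lebesgue" "T \<subseteq> A" "T \<subseteq> cell p"
    and low: "\<And>u j. u \<in> T \<Longrightarrow> fst p \<le> j \<Longrightarrow> dens A (dyad j u) \<le> b" and b: "b < 1"
  shows "negligible T"
proof (rule ccontr)
  assume "\<not> negligible T"
  have Tl: "T \<in> lmeasurable"
    using fmeasurableI2[OF cell_lmeasurable T(3,1)] .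
  define \<tau> where "\<tau> = measure lebesgue T"
  have \<tau>: "0 < \<tau>"
    using \<open>\<not> negligible T\<close> Tl negligible_iff_measure[of T] by (simp add: \<tau>_def zero_less_measure_iff)
  then obtain v where "v \<in> T"
    unfolding \<tau>_def by fastforce
  then have b0: "0 \<le> b"
    using low[of v "fst p"] dens_bounds(1)[OF A, of "dyad (fst p) v"] by linarith
  \<comment> \<open>The losses below add up to \<open>2 * e\<close>, while the argument leads to
    \<tau> (1 - b) = 3e being at most that loss.\<close>
  define e where "e = \<tau> * (1 - b) / 3"
  have e: "0 < e"
    using \<tau> b by (simp add: e_def)
  obtain U where U: "open U" "T \<subseteq> U" "U - T \<in> lmeasurable" "emeasure lebesgue (U - T) < ennreal e"
    using sets_lebesgue_outer_open[OF T(1) e] by blast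
  have mU: "measure lebesgue (U - T) < e"
    using U(3,4) e by (simp add: emeasure_eq_measure2 ennreal_less_iff)
  \<comment> \<open>Cubes are required to meet \<open>T\<close> so that the bound \<open>b\<close>
    applies to them, and to lie in \<open>U\<close> so that their total measure exceeds that of
    \<open>T\<close> by less than \<open>e\<close>.\<close>
  define S where "S = (\<lambda>q. cell q \<subseteq> U \<and> cell q \<inter> T \<noteq> {})"
  have "{u \<in> T. \<forall>j\<ge>fst p. \<not> S (dyad j u)} = {}"
  proof -
    have "\<exists>j\<ge>fst p. S (dyad j u)" if u: "u \<in> T" for u
    proof -
      obtain j where "fst p \<le> j" "cell (dyad j u) \<subseteq> U"
        using dyad_eventually_subset[OF U(1), of u "fst p"] u U(2) by blast
      then show ?thesis
        using that mem_cell_dyad[of u j] unfolding S_def by blast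
    qed
    then show ?thesis
      by blast
  qed
  then have "negligible {u \<in> T. \<forall>j\<ge>fst p. \<not> S (dyad j u)}"
    by (simp only: negligible_empty)
  then obtain M where M: "measure lebesgue (T - (\<Union>q\<in>first_cells p S M. cell q)) < e"
    using first_cells_exhaust[OF Tl T(3) _ e, of S] by blast
  define F where "F = first_cells p S M"
  define W where "W = (\<Union>q\<in>F. cell q)"
  have F: "finite F" "pairwise (\<lambda>q r. disjnt (cell q) (cell r)) F"
    unfolding F_def by (rule finite_first_cells disjoint_first_cells)+
  have W: "W \<in> lmeasurable"
    unfolding W_def using F by (intro fmeasurable.finite_UN) auto
  have "measure lebesgue (A \<inter> W) = (\<Sum>q\<in>F. dens A q * measure lebesgue (cell q))"
    unfolding W_def by (rule measure_Int_UN_cells[OF F A])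
  also have "\<dots> \<le> (\<Sum>q\<in>F. b * measure lebesgue (cell q))"
  proof (intro sum_mono mult_right_mono)
    fix q assume "q \<in> F"
    then obtain u where "u \<in> T" "u \<in> cell q" "fst p \<le> fst q"
      by (auto simp: F_def first_cells_def S_def)
    then show "dens A q \<le> b"
      using low[of u "fst q"] by (simp add: mem_cell)
  qed simp
  also have "\<dots> = b * measure lebesgue W"
    unfolding W_def by (simp add: measure_UN_cells[OF F] sum_distrib_left)
  also have "\<dots> \<le> b * (\<tau> + e)"
  proof (intro mult_left_mono b0)
    have "W \<subseteq> T \<union> (U - T)"
      by (auto simp: W_def F_def first_cells_def S_def)
    then have "measure lebesgue W \<le> measure lebesgue (T \<union> (U - T))"
      using W Tl U(3) by (intro measure_mono_fmeasurable fmeasurable.Un) auto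
    also have "\<dots> \<le> \<tau> + measure lebesgue (U - T)"
      unfolding \<tau>_def using Tl U(3) by (intro measure_Un_le) auto
    finally show "measure lebesgue W \<le> \<tau> + e"
      using mU by linarith
  qed
  finally have AW: "measure lebesgue (A \<inter> W) \<le> b * (\<tau> + e)" .
  have AWl: "A \<inter> W \<in> lmeasurable"
    using A W by (intro fmeasurableI2[OF W]) auto
  have TW: "T - W \<in> lmeasurable"
    using T W by (intro fmeasurableI2[OF Tl]) auto
  have "\<tau> \<le> measure lebesgue (A \<inter> W \<union> (T - W))"
    unfolding \<tau>_def using T(2) AWl TW Tl by (intro measure_mono_fmeasurable fmeasurable.Un) auto
  also have "\<dots> \<le> measure lebesgue (A \<inter> W) + measure lebesgue (T - W)"
    using AWl TW by (intro measure_Un_le) auto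
  also have "\<dots> \<le> b * (\<tau> + e) + e"
    using AW M unfolding W_def F_def by linarith
  also have "\<dots> \<le> b * \<tau> + 2 * e"
    using b b0 e mult_left_le_one_le[of e b] by (simp add: algebra_simps)
  finally have "\<tau> * (1 - b) \<le> 2 * e"
    by (simp add: algebra_simps)
  then show False
    using \<tau> b by (simp add: e_def)
qed

text \<open>Inside \<open>A\<close> the densities stay below \<open>b < 1\<close>; outside
  \<open>A\<close> those of the complement stay below \<open>1 - a < 1\<close>. Each half is null by
  the preceding lemma, so almost everywhere convergence of the densities need not be proved.\<close>

lemma negligible_trapped:
  fixes A :: "(real ^ 'n) set"
  assumes A: "A \<in> sets lebesgue" and ab: "0 < a" "b < 1"
  shows "negligible {u \<in> cell p. \<forall>j\<ge>fst p. a < dens A (dyad j u) \<and> dens A (dyad j u) < b}"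
    (is "negligible ?Z")
proof -
  have "?Z = cell p \<inter> (\<Inter>j\<in>{fst p..}. {u. a < dens A (dyad j u) \<and> dens A (dyad j u) < b})"
    unfolding set_eq_iff Int_iff INT_iff mem_Collect_eq atLeast_iff by blast
  also have "\<dots> \<in> sets lebesgue"
    by (intro sets.Int cell_sets sets.countable_INT'' dyad_pred_sets) auto
  finally have Z: "?Z \<in> sets lebesgue" .
  have "negligible (?Z \<inter> A)"
  proof (rule negligible_low_density[OF A _ _ _ _ ab(2)])
    show "?Z \<inter> A \<in> sets lebesgue"
      using Z A by (rule sets.Int)
    show "?Z \<inter> A \<subseteq> A" "?Z \<inter> A \<subseteq> cell p"
      by blast+
    show "dens A (dyad j u) \<le> b" if "u \<in> ?Z \<inter> A" "fst p \<le> j" for u j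
      using that by fastforce
  qed
  moreover have "negligible (?Z \<inter> - A)"
  proof (rule negligible_low_density)
    show A': "- A \<in> sets lebesgue"
      using A by (simp add: Compl_in_sets_lebesgue)
    show "?Z \<inter> - A \<in> sets lebesgue"
      using Z A' by (rule sets.Int)
    show "?Z \<inter> - A \<subseteq> - A" "?Z \<inter> - A \<subseteq> cell p"
      by blast+
    show "dens (- A) (dyad j u) \<le> 1 - a" if "u \<in> ?Z \<inter> - A" "fst p \<le> j" for u j
      using that unfolding dens_compl[OF A] by fastforce
    show "1 - a < 1"
      using ab by simp
  qed
  ultimately have "negligible (?Z \<inter> A \<union> ?Z \<inter> - A)"
    by (rule negligible_Un)
  then show ?thesis
    by (rule negligible_subset) blast
qed

text \<open>The density along dyadic cubes is a bounded martingale, which leaves \<open>(a, b)\<close> almost surely;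
  optional stopping bounds below the proportion of cubes that leave it through the top.\<close>

lemma exit_top:
  fixes A :: "(real ^ 'n) set"
  assumes A: "A \<in> sets lebesgue" and ab: "0 < a" "b < 1" "a < dens A p" "dens A p < b" and w: "0 \<le> w"
    and inc: "\<And>u j. fst p \<le> j \<Longrightarrow> dens A (dyad (Suc j) u) \<le> dens A (dyad j u) + w"
    and c: "c * (b + w - a) < dens A p - a"
  obtains F where "finite F" "pairwise (\<lambda>q r. disjnt (cell q) (cell r)) F"
    "\<And>q. q \<in> F \<Longrightarrow> cell q \<subseteq> cell p" "\<And>q. q \<in> F \<Longrightarrow> fst p < fst q" "\<And>q. q \<in> F \<Longrightarrow> b \<le> dens A q"
    "\<And>q u j. q \<in> F \<Longrightarrow> u \<in> cell q \<Longrightarrow> fst p \<le> j \<Longrightarrow> j < fst q \<Longrightarrow>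
       a < dens A (dyad j u) \<and> dens A (dyad j u) < b"
    "c * measure lebesgue (cell p) \<le> (\<Sum>q\<in>F. measure lebesgue (cell q))"
proof -
  define S where "S = (\<lambda>q. \<not> (a < dens A q \<and> dens A q < b))"
  have mp: "0 < measure lebesgue (cell p)"
    by (simp add: measure_cell)
  \<comment> \<open>The strict inequality on \<open>c\<close> leaves this much slack, which pays for
    the part of \<open>p\<close> that is not stopped by level \<open>M\<close>.\<close>
  define e where "e = (dens A p - a - c * (b + w - a)) * measure lebesgue (cell p)"
  have e: "0 < e"
    using c mp by (simp add: e_def)
  have "negligible {u \<in> cell p. \<forall>j\<ge>fst p. \<not> S (dyad j u)}"
    using negligible_trapped[OF A ab(1,2), of p] by (simp add: S_def)
  then obtain M where M: "measure lebesgue (cell p - (\<Union>q\<in>first_cells p S M. cell q)) < e"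
    using first_cells_exhaust[OF cell_lmeasurable order_refl _ e, of p S] by blast
  define G where "G = first_cells p S M"
  define F where "F = {q \<in> G. b \<le> dens A q}"
  define W where "W = (\<Union>q\<in>G. cell q)"
  have G: "finite G" "pairwise (\<lambda>q r. disjnt (cell q) (cell r)) G"
    unfolding G_def by (rule finite_first_cells disjoint_first_cells)+
  have W: "W \<in> lmeasurable" "W \<subseteq> cell p"
  proof -
    show "W \<in> lmeasurable"
      unfolding W_def using G by (intro fmeasurable.finite_UN) auto
    show "W \<subseteq> cell p"
      unfolding W_def G_def first_cells_def by blast
  qed
  \<comment> \<open>Since \<open>p\<close> itself lies strictly inside the corridor, stopping
    happens at a later level and every stopped cube has a parent still inside.\<close>
  have lvl: "fst p < fst q" if "q \<in> G" for q
  proof (rule ccontr)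
    assume "\<not> fst p < fst q"
    then have "fst q = fst p" "cell q \<subseteq> cell p" "S q"
      using that by (auto simp: G_def first_cells_def)
    then have "q = p"
      using centre_in_cell[of q] by (metis mem_cell subsetD)
    then show False
      using \<open>S q\<close> ab by (simp add: S_def)
  qed
  have between: "a < dens A (dyad j u) \<and> dens A (dyad j u) < b"
    if "q \<in> G" "u \<in> cell q" "fst p \<le> j" "j < fst q" for q u j
    using that by (auto simp: G_def first_cells_def S_def)
  \<comment> \<open>The parent is below \<open>b\<close>, so the overshoot is at most one
    increment.\<close>
  have top: "dens A q \<le> b + w" if "q \<in> G" for q
  proof -
    define j where "j = fst q - 1"
    have j: "fst p \<le> j" "fst q = Suc j"
      using lvl[OF that] by (auto simp: j_def)
    have "dens A (dyad j (centre q)) < b"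
      using between[OF that centre_in_cell, of j] j by simp
    moreover have "dyad (Suc j) (centre q) = q"
      using centre_in_cell[of q] j by (simp add: mem_cell)
    ultimately show ?thesis
      using inc[OF j(1), of "centre q"] by simp
  qed
  have "measure lebesgue (A \<inter> cell p) \<le> measure lebesgue (A \<inter> W \<union> (cell p - W))"
    using A W by (intro measure_mono_fmeasurable fmeasurable.Un)
      (auto intro: fmeasurableI2[OF cell_lmeasurable[of p]])
  also have "\<dots> \<le> measure lebesgue (A \<inter> W) + measure lebesgue (cell p - W)"
    using A W by (intro measure_Un_le) auto
  also have "measure lebesgue (A \<inter> W) = (\<Sum>q\<in>G. dens A q * measure lebesgue (cell q))"
    unfolding W_def by (rule measure_Int_UN_cells[OF G A])
  also have "\<dots> \<le> (\<Sum>q\<in>G. a * measure lebesgue (cell q) +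
      (if q \<in> F then (b + w - a) * measure lebesgue (cell q) else 0))"
  proof (rule sum_mono)
    fix q assume q: "q \<in> G"
    \<comment> \<open>A stopped cube that did not leave through the top left through the bottom, and
      its density is at most \<open>a\<close>.\<close>
    have "dens A q \<le> a + (if q \<in> F then b + w - a else 0)"
      using q top[OF q] by (auto simp: F_def G_def first_cells_def S_def)
    then have "dens A q * measure lebesgue (cell q)
        \<le> (a + (if q \<in> F then b + w - a else 0)) * measure lebesgue (cell q)"
      by (rule mult_right_mono) simp
    then show "dens A q * measure lebesgue (cell q) \<le> a * measure lebesgue (cell q) +
      (if q \<in> F then (b + w - a) * measure lebesgue (cell q) else 0)"
      by (auto simp: algebra_simps split: if_splits)
  qed
  also have "\<dots> = a * measure lebesgue W + (b + w - a) * (\<Sum>q\<in>F. measure lebesgue (cell q))"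
  proof -
    have "G \<inter> {q. q \<in> F} = F"
      by (auto simp: F_def)
    then show ?thesis
      unfolding W_def using G
      by (simp add: sum.distrib sum.If_cases measure_UN_cells[OF G] flip: sum_distrib_left)
  qed
  also have "a * measure lebesgue W \<le> a * measure lebesgue (cell p)"
    using W ab by (intro mult_left_mono measure_mono_fmeasurable) auto
  finally have "dens A p * measure lebesgue (cell p) \<le> a * measure lebesgue (cell p) +
      (b + w - a) * (\<Sum>q\<in>F. measure lebesgue (cell q)) + e"
    using M by (simp add: measure_Int_cell[OF A] W_def G_def)
  then have "(b + w - a) * (c * measure lebesgue (cell p))
      \<le> (b + w - a) * (\<Sum>q\<in>F. measure lebesgue (cell q))"
    by (simp add: e_def algebra_simps)
  then have "c * measure lebesgue (cell p) \<le> (\<Sum>q\<in>F. measure lebesgue (cell q))"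
    using ab w by (simp add: mult_le_cancel_left_pos)
  moreover have "finite F" "pairwise (\<lambda>q r. disjnt (cell q) (cell r)) F"
    using G by (auto simp: F_def intro: pairwise_subset)
  moreover have "F \<subseteq> G" "\<And>q. q \<in> F \<Longrightarrow> b \<le> dens A q" "\<And>q. q \<in> G \<Longrightarrow> cell q \<subseteq> cell p"
    unfolding F_def G_def first_cells_def by blast+
  ultimately show thesis
    using that[of F] lvl between by blast
qed

section \<open>Oscillation of the density\<close>

lemma cell_near_centre: "u \<in> ccell q \<Longrightarrow> \<bar>u $ i - centre q $ i\<bar> \<le> side q / 2"
  by (simp add: ccell_def mem_cube)

text \<open>Records the consequences of smoothness on which the stopping argument and the limit of
  densities rest.\<close>

locale density_modulus =
  fixes A :: "(real ^ 'n) set" and w :: "nat \<Rightarrow> real"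
  assumes A: "A \<in> sets lebesgue"
    and antimono_w: "antimono w" and w_pos: "0 < w m" and w_lim: "w \<longlonglongrightarrow> 0"
    and comparable: "\<lbrakk>0 < l; l \<le> h; h \<le> 2 * l; h \<le> 2 / 2 ^ m; \<And>i. \<bar>x $ i - y $ i\<bar> \<le> h\<rbrakk> \<Longrightarrow>
      \<bar>set_density A (cube x h) - set_density A (cube y l)\<bar> \<le> w m"
begin

lemma w_mono: "m \<le> m' \<Longrightarrow> w m' \<le> w m"
  using antimono_w by (rule antimonoD)

text \<open>The parent has side \<open>2 / 2 ^ Suc j\<close>, which is why the modulus can be taken
  at the finer level.\<close>

lemma dens_step: "\<bar>dens A (dyad (Suc j) u) - dens A (dyad j u)\<bar> \<le> w (Suc j)"
proof -
  let ?p = "dyad j u" and ?q = "dyad (Suc j) u"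
  have "\<bar>set_density A (cube (centre ?p) (side ?p)) - set_density A (cube (centre ?q) (side ?q))\<bar> \<le> w (Suc j)"
  proof (rule comparable)
    fix i
    have "\<bar>u $ i - centre ?p $ i\<bar> \<le> side ?p / 2" "\<bar>u $ i - centre ?q $ i\<bar> \<le> side ?q / 2"
      using cell_subset_ccell mem_cell_dyad by (blast intro: cell_near_centre)+
    moreover have "side ?q = side ?p / 2"
      by (simp add: side_def)
    ultimately show "\<bar>centre ?p $ i - centre ?q $ i\<bar> \<le> side ?p"
      using side_pos(1)[of ?p] by linarith
  qed (auto simp: side_def field_simps)
  then show ?thesis
    by (simp add: dens_def ccell_def abs_minus_commute)
qed

text \<open>Read backwards, this says that a large change of density takes many generations.\<close>

lemma dens_iterate: "\<bar>dens A (dyad (m + i) u) - dens A (dyad m u)\<bar> \<le> i * w m"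
proof (induction i)
  case (Suc i)
  have "w (Suc (m + i)) \<le> w m"
    by (rule w_mono) simp
  then show ?case
    using Suc dens_step[of "m + i" u] by (simp add: algebra_simps)
qed simp

lemma dens_adjacent: "\<bar>dens A (m, k + axis i 1) - dens A (m, k)\<bar> \<le> w m"
proof -
  have c: "centre (m, k + axis i 1) $ j - centre (m, k) $ j = (if i = j then 1 / 2 ^ m else 0)" for j
    by (simp add: centre_def gcen_def side_def axis_def algebra_simps)
  show ?thesis
    unfolding dens_def ccell_def side_def fst_conv
    by (rule comparable) (unfold c, auto simp: field_simps)
qed

text \<open>The rise by \<open>K * w (fst p)\<close> forces the new cubes to be deep. The return
  brings the density back to within one increment of \<alpha>, measured at the new level, so errors
  do not accumulate and the step can be iterated.\<close>

lemma oscillation_step: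
  assumes K: "K = real N + 3" and \<alpha>: "3 * K * w (fst p) < \<alpha>" "3 * K * w (fst p) < 1 - \<alpha>"
    and near: "\<bar>dens A p - \<alpha>\<bar> \<le> w (fst p)"
  obtains G where "finite G" "pairwise (\<lambda>q r. disjnt (cell q) (cell r)) G"
    "\<And>q. q \<in> G \<Longrightarrow> cell q \<subseteq> cell p" "\<And>q. q \<in> G \<Longrightarrow> fst p + N < fst q"
    "\<And>q. q \<in> G \<Longrightarrow> \<bar>dens A q - \<alpha>\<bar> \<le> w (fst q)"
    "\<And>q u j. q \<in> G \<Longrightarrow> u \<in> cell q \<Longrightarrow> fst p \<le> j \<Longrightarrow> j < fst q \<Longrightarrow>
       \<bar>dens A (dyad j u) - \<alpha>\<bar> \<le> 3 * K * w (fst p)"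
    "measure lebesgue (cell p) / 16 \<le> (\<Sum>q\<in>G. measure lebesgue (cell q))"
proof -
  define e where "e = w (fst p)"
  define d where "d = K * e"
  have e: "0 < e"
    by (simp add: e_def w_pos)
  have d: "3 * e \<le> d"
    unfolding d_def using e K by (intro mult_right_mono) auto
  have \<alpha>d: "3 * d < \<alpha>" "3 * d < 1 - \<alpha>"
    using \<alpha> by (simp_all add: d_def e_def)
  have near': "\<bar>dens A p - \<alpha>\<bar> \<le> e"
    using near by (simp add: e_def)
  have step: "\<bar>dens A (dyad (Suc j) u) - dens A (dyad j u)\<bar> \<le> e" if "fst p \<le> j" for j u
    using dens_step[of j u] w_mono[of "fst p" "Suc j"] that unfolding e_def by linarith
  have range: "0 < \<alpha> - d" "\<alpha> + d < 1" "\<alpha> - d < dens A p" "dens A p < \<alpha> + d" "0 \<le> e"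
    using \<alpha>d d e near' by linarith+
  have "\<alpha> - e \<le> dens A p"
    using near' by linarith
  \<comment> \<open>The optional stopping ratio is at least (d - e) / (2d + e), which exceeds 1/4
    because d is at least 3e. The same ratio recurs in the second phase.\<close>
  then have c: "1 / 4 * (\<alpha> + d + e - (\<alpha> - d)) < dens A p - (\<alpha> - d)"
    using d e by (simp add: field_simps)
  obtain F where F: "finite F" "pairwise (\<lambda>q r. disjnt (cell q) (cell r)) F"
    and F_sub: "\<And>q. q \<in> F \<Longrightarrow> cell q \<subseteq> cell p" and F_lvl: "\<And>q. q \<in> F \<Longrightarrow> fst p < fst q"
    and F_top: "\<And>q. q \<in> F \<Longrightarrow> \<alpha> + d \<le> dens A q"
    and F_between: "\<And>q u j. q \<in> F \<Longrightarrow> u \<in> cell q \<Longrightarrow> fst p \<le> j \<Longrightarrow> j < fst q \<Longrightarrow>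
       \<alpha> - d < dens A (dyad j u) \<and> dens A (dyad j u) < \<alpha> + d"
    and F_sum: "1 / 4 * measure lebesgue (cell p) \<le> (\<Sum>q\<in>F. measure lebesgue (cell q))"
  proof (rule exit_top[OF A range _ c])
    show "dens A (dyad (Suc j) u) \<le> dens A (dyad j u) + e" if "fst p \<le> j" for u j
      using step[OF that, of u] by linarith
  qed blast
  have top: "dens A q \<le> \<alpha> + d + e" if "q \<in> F" for q
  proof -
    define j where "j = fst q - 1"
    have j: "fst p \<le> j" "fst q = Suc j"
      using F_lvl[OF that] by (auto simp: j_def)
    then have "dens A (dyad j (centre q)) < \<alpha> + d"
      using F_between[OF that centre_in_cell, of j] by simp
    then show ?thesis
      using step[OF j(1), of "centre q"] centre_in_cell[of q] j(2) by (simp add: mem_cell)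
  qed
  have lvl: "fst p + N < fst q" if "q \<in> F" for q
  proof -
    define i where "i = fst q - fst p"
    have i: "fst q = fst p + i"
      using F_lvl[OF that] by (simp add: i_def)
    have "dyad (fst p + i) (centre q) = q"
      using centre_in_cell[of q] i by (simp add: mem_cell)
    moreover have "dyad (fst p) (centre q) = p"
      using centre_in_cell[of q] F_sub[OF that] by (auto simp: mem_cell)
    \<comment> \<open>The density climbs from at most \<alpha> + e to at least \<alpha> + d in
      \<open>i\<close> steps of size at most \<open>e\<close>; hence \<open>i\<close> is at least K
      - 1 = N + 2.\<close>
    ultimately have "d - e \<le> i * e"
      using dens_iterate[of "fst p" i "centre q"] F_top[OF that] near' unfolding e_def by simp
    then have "(K - 1) * e \<le> i * e"
      by (simp add: d_def algebra_simps)
    then have "K - 1 \<le> i"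
      using e by simp
    then show ?thesis
      using i K by simp
  qed
  \<comment> \<open>The second phase is a descent from about \<alpha> + d to \<alpha>, giving up at
    \<alpha> + 2d. It is obtained as an ascent for the complement of \<open>A\<close>, with the
    corridor reflected.\<close>
  have "\<forall>q\<in>F. \<exists>H. finite H \<and> pairwise (\<lambda>q r. disjnt (cell q) (cell r)) H \<and>
    (\<forall>r\<in>H. cell r \<subseteq> cell q \<and> fst q < fst r \<and> dens A r \<le> \<alpha> \<and>
      (\<forall>u\<in>cell r. \<forall>j. fst q \<le> j \<longrightarrow> j < fst r \<longrightarrow> \<alpha> < dens A (dyad j u) \<and> dens A (dyad j u) < \<alpha> + 2 * d)) \<and>
    1 / 4 * measure lebesgue (cell q) \<le> (\<Sum>r\<in>H. measure lebesgue (cell r))"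
    (is "\<forall>q\<in>F. \<exists>H. ?P q H")
  proof
    fix q assume q: "q \<in> F"
    have lq: "fst p < fst q"
      by (rule F_lvl[OF q])
    have A': "- A \<in> sets lebesgue"
      using A by (simp add: Compl_in_sets_lebesgue)
    have range: "0 < 1 - \<alpha> - 2 * d" "1 - \<alpha> < 1" "1 - \<alpha> - 2 * d < dens (- A) q" "dens (- A) q < 1 - \<alpha>" "0 \<le> e"
      using \<alpha>d d e F_top[OF q] top[OF q] unfolding dens_compl[OF A] by linarith+
    have c: "1 / 4 * (1 - \<alpha> + e - (1 - \<alpha> - 2 * d)) < dens (- A) q - (1 - \<alpha> - 2 * d)"
      using d e top[OF q] unfolding dens_compl[OF A] by (simp add: field_simps)
    obtain H where H: "finite H" "pairwise (\<lambda>q r. disjnt (cell q) (cell r)) H"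
      "\<And>r. r \<in> H \<Longrightarrow> cell r \<subseteq> cell q" "\<And>r. r \<in> H \<Longrightarrow> fst q < fst r"
      "\<And>r. r \<in> H \<Longrightarrow> 1 - \<alpha> \<le> dens (- A) r"
      "\<And>r u j. r \<in> H \<Longrightarrow> u \<in> cell r \<Longrightarrow> fst q \<le> j \<Longrightarrow> j < fst r \<Longrightarrow>
         1 - \<alpha> - 2 * d < dens (- A) (dyad j u) \<and> dens (- A) (dyad j u) < 1 - \<alpha>"
      "1 / 4 * measure lebesgue (cell q) \<le> (\<Sum>r\<in>H. measure lebesgue (cell r))"
    proof (rule exit_top[OF A' range _ c])
      show "dens (- A) (dyad (Suc j) u) \<le> dens (- A) (dyad j u) + e" if "fst q \<le> j" for u j
        using step[of j u] that lq unfolding dens_compl[OF A] by linarith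
    qed blast
    have "dens A r \<le> \<alpha>" if "r \<in> H" for r
      using H(5)[OF that] by (simp add: dens_compl[OF A])
    moreover have "\<alpha> < dens A (dyad j u) \<and> dens A (dyad j u) < \<alpha> + 2 * d"
      if "r \<in> H" "u \<in> cell r" "fst q \<le> j" "j < fst r" for r u j
      using H(6)[OF that] by (simp add: dens_compl[OF A])
    ultimately show "\<exists>H. ?P q H"
      using H(1-4,7) by blast
  qed
  then obtain H where P: "\<forall>q\<in>F. ?P q (H q)"
    by (elim bchoice[THEN exE])
  have H: "\<And>q. q \<in> F \<Longrightarrow> finite (H q)"
    "\<And>q. q \<in> F \<Longrightarrow> pairwise (\<lambda>q r. disjnt (cell q) (cell r)) (H q)"
    and H_sub: "\<And>q r. q \<in> F \<Longrightarrow> r \<in> H q \<Longrightarrow> cell r \<subseteq> cell q"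
    and H_lvl: "\<And>q r. q \<in> F \<Longrightarrow> r \<in> H q \<Longrightarrow> fst q < fst r"
    and H_bot: "\<And>q r. q \<in> F \<Longrightarrow> r \<in> H q \<Longrightarrow> dens A r \<le> \<alpha>"
    and H_between: "\<And>q r u j. q \<in> F \<Longrightarrow> r \<in> H q \<Longrightarrow> u \<in> cell r \<Longrightarrow> fst q \<le> j \<Longrightarrow> j < fst r \<Longrightarrow>
       \<alpha> < dens A (dyad j u) \<and> dens A (dyad j u) < \<alpha> + 2 * d"
    and H_sum: "\<And>q. q \<in> F \<Longrightarrow> 1 / 4 * measure lebesgue (cell q) \<le> (\<Sum>r\<in>H q. measure lebesgue (cell r))"
    using P by blast+
  define G where "G = (\<Union>q\<in>F. H q)"
  have cross: "disjnt (cell r) (cell r')"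
    if "q \<in> F" "q' \<in> F" "q \<noteq> q'" "r \<in> H q" "r' \<in> H q'" for q q' r r'
    using F(2) H_sub[OF that(1,4)] H_sub[OF that(2,5)] that(1-3)
    unfolding pairwise_def disjnt_def by blast
  have ne: "cell r \<noteq> {}" for r
    using centre_in_cell by blast
  show thesis
  proof
    show "finite G"
      unfolding G_def using F H by blast
    show "pairwise (\<lambda>q r. disjnt (cell q) (cell r)) G"
      unfolding pairwise_def
    proof (intro ballI impI)
      fix r r' assume "r \<in> G" "r' \<in> G" and rr: "r \<noteq> r'"
      then obtain q q' where q: "q \<in> F" "r \<in> H q" "q' \<in> F" "r' \<in> H q'"
        by (auto simp: G_def)
      show "disjnt (cell r) (cell r')"
      proof (cases "q = q'")
        case True
        then show ?thesis
          using H(2)[OF q(1)] q rr unfolding pairwise_def by blast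
      next
        case False
        then show ?thesis
          using cross q by blast
      qed
    qed
    fix r assume "r \<in> G"
    then obtain q where q: "q \<in> F" "r \<in> H q"
      by (auto simp: G_def)
    show "cell r \<subseteq> cell p"
      using H_sub[OF q] F_sub[OF q(1)] by blast
    show "fst p + N < fst r"
      using lvl[OF q(1)] H_lvl[OF q] by linarith
    show "\<bar>dens A r - \<alpha>\<bar> \<le> w (fst r)"
    proof -
      \<comment> \<open>The parent of \<open>r\<close> still has density above \<alpha> while
        \<open>r\<close> does not, so \<alpha> lies within the last increment, which is bounded by
        \<open>w (fst r)\<close>.\<close>
      define j where "j = fst r - 1"
      have j: "fst q \<le> j" "fst r = Suc j"
        using H_lvl[OF q] by (auto simp: j_def)
      then have "\<alpha> < dens A (dyad j (centre r))"
        using H_between[OF q centre_in_cell, of j] by simp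
      moreover have "dyad (Suc j) (centre r) = r"
        using centre_in_cell[of r] j(2) by (simp add: mem_cell)
      ultimately show ?thesis
        using dens_step[of j "centre r"] H_bot[OF q] j(2) by simp
    qed
    fix u j assume u: "u \<in> cell r" and j: "fst p \<le> j" "j < fst r"
    have "\<bar>dens A (dyad j u) - \<alpha>\<bar> \<le> 3 * d"
    proof (cases "j < fst q")
      case True
      moreover have "u \<in> cell q"
        using u H_sub[OF q] by blast
      ultimately show ?thesis
        using F_between[OF q(1) _ j(1), of u] d e by linarith
    next
      case False
      then show ?thesis
        using H_between[OF q u _ j(2)] d e by linarith
    qed
    then show "\<bar>dens A (dyad j u) - \<alpha>\<bar> \<le> 3 * K * w (fst p)"
      by (simp add: d_def e_def)
  next
    have "measure lebesgue (cell p) / 16 \<le> 1 / 4 * (\<Sum>q\<in>F. measure lebesgue (cell q))"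
      using F_sum by simp
    also have "\<dots> \<le> (\<Sum>q\<in>F. \<Sum>r\<in>H q. measure lebesgue (cell r))"
      unfolding sum_distrib_left by (rule sum_mono) (rule H_sum)
    also have "\<dots> = (\<Sum>r\<in>G. measure lebesgue (cell r))"
    proof -
      have "H q \<inter> H q' = {}" if "q \<in> F" "q' \<in> F" "q \<noteq> q'" for q q'
        using cross[OF that] ne unfolding disjnt_def by blast
      then show ?thesis
        unfolding G_def using F H by (subst sum.UNION_disjoint) auto
    qed
    finally show "measure lebesgue (cell p) / 16 \<le> (\<Sum>q\<in>G. measure lebesgue (cell q))" .
  qed
qed

text \<open>A centred cube of side \<open>h\<close> is compared with the dyadic cube
  \<open>c j\<close> for which h lies between half its side and its side. The point need only belong
  to the closed cubes, as the comparison tolerates shifted centres.\<close>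

lemma density_tendsto:
  assumes c: "\<And>j. m \<le> j \<Longrightarrow> fst (c j) = j" "\<And>j. m \<le> j \<Longrightarrow> x \<in> ccell (c j)"
    and lim: "(\<lambda>j. dens A (c j)) \<longlonglongrightarrow> \<alpha>"
  shows "((\<lambda>h. set_density A (cube x h)) \<longlongrightarrow> \<alpha>) (at_right 0)"
proof (rule tendstoI)
  fix e :: real assume e: "0 < e"
  have "eventually (\<lambda>j. dist (dens A (c j)) \<alpha> < e / 2) sequentially"
    using lim e by (intro tendstoD) auto
  moreover have "eventually (\<lambda>j. w j < e / 2) sequentially"
    using w_lim e by (intro order_tendstoD) auto
  moreover have "eventually (\<lambda>j. m \<le> j) sequentially"
    by (rule eventually_ge_at_top)
  ultimately have "eventually (\<lambda>j. m \<le> j \<and> w j < e / 2 \<and> dist (dens A (c j)) \<alpha> < e / 2) sequentially"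
    by eventually_elim simp
  then obtain J where J: "\<And>j. J \<le> j \<Longrightarrow> m \<le> j \<and> w j < e / 2 \<and> dist (dens A (c j)) \<alpha> < e / 2"
    unfolding eventually_sequentially by blast
  have "dist (set_density A (cube x h)) \<alpha> < e" if h: "0 < h" "h < 1 / 2 ^ J" for h
  proof -
    obtain i0 where "(1 / 2) ^ i0 < h"
      using real_arch_pow_inv[OF h(1), of "1 / 2"] by auto
    then have ex: "\<exists>i. 1 / 2 ^ i < h"
      by (auto simp: power_one_over)
    \<comment> \<open>The level just before the first side below \<open>h\<close> has side at least
      \<open>h\<close> and less than \<open>2 * h\<close>.\<close>
    define i where "i = (LEAST i. 1 / 2 ^ i < h)"
    have i: "1 / 2 ^ i < h"
      unfolding i_def using ex by (rule LeastI_ex)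
    have "J < i"
    proof (rule ccontr)
      assume "\<not> J < i"
      then have "(1 :: real) / 2 ^ J \<le> 1 / 2 ^ i"
        by (intro divide_left_mono power_increasing) auto
      then show False
        using i h by linarith
    qed
    define j where "j = i - 1"
    have j: "J \<le> j" "i = Suc j"
      using \<open>J < i\<close> by (auto simp: j_def)
    have "\<not> 1 / 2 ^ j < h"
      unfolding i_def using j(2) not_less_Least[of j "\<lambda>i. 1 / 2 ^ i < h"] by (simp add: i_def)
    then have hj: "h \<le> 1 / 2 ^ j"
      by simp
    have hj': "1 / 2 ^ j \<le> 2 * h"
      using i j(2) by simp
    have mj: "m \<le> j"
      using J[OF j(1)] by blast
    then have side: "side (c j) = 1 / 2 ^ j"
      using c(1) by (simp add: side_def)
    have "\<bar>set_density A (cube (centre (c j)) (side (c j))) - set_density A (cube x h)\<bar> \<le> w j"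
    proof (rule comparable)
      fix i
      show "\<bar>centre (c j) $ i - x $ i\<bar> \<le> side (c j)"
        using cell_near_centre[OF c(2)[OF mj], of i] side_pos(1)[of "c j"] by linarith
    qed (use h hj hj' in \<open>simp_all add: side divide_right_mono\<close>)
    then show ?thesis
      using J[OF j(1)] unfolding dens_def ccell_def dist_real_def by linarith
  qed
  then show "eventually (\<lambda>h. dist (set_density A (cube x h)) \<alpha> < e) (at_right 0)"
    unfolding eventually_at_right_field by (intro exI[of _ "1 / 2 ^ J"]) auto
qed

end

section \<open>Starting cubes with density near \<alpha>\<close>

text \<open>Otherwise \<open>A\<close> would have density at most \<open>b\<close> in all cubes of
  level at least \<open>m\<close>, and would be null inside each of the countably many cubes of
  level \<open>m\<close>.\<close>

lemma dense_cell_exists: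
  fixes A :: "(real ^ 'n) set"
  assumes A: "A \<in> sets lebesgue" "emeasure lebesgue A > 0" and b: "b < 1"
  obtains p :: "'n dyadic" where "m \<le> fst p" "b < dens A p"
proof (rule ccontr)
  assume "\<not> thesis"
  with that have low: "\<And>p :: 'n dyadic. m \<le> fst p \<Longrightarrow> dens A p \<le> b"
    by (meson not_le)
  have "negligible (A \<inter> cell p)" if "fst p = m" for p
    by (rule negligible_low_density[OF A(1) _ _ _ _ b, of _ p]) (use A that low in auto)
  then have "negligible (\<Union>((\<lambda>p. A \<inter> cell p) ` {p. fst p = m}))"
    by (intro negligible_countable_Union) auto
  moreover have "A \<subseteq> \<Union>((\<lambda>p. A \<inter> cell p) ` {p. fst p = m})"
  proof
    fix u assume "u \<in> A"
    then show "u \<in> \<Union>((\<lambda>p. A \<inter> cell p) ` {p. fst p = m})"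
      by (intro UN_I[of "dyad m u"]) auto
  qed
  ultimately have "negligible A"
    by (rule negligible_subset)
  then show False
    using A(2) by (simp add: negligible_iff_emeasure0 A(1))
qed

text \<open>The density in \<open>p\<close> is the average over its subcubes of level
  \<open>M\<close>. This brings two cubes to a common level, where they belong to one
  lattice.\<close>

lemma dense_subcell_exists:
  assumes A: "A \<in> sets lebesgue" and p: "b < dens A p" "fst p \<le> M"
  obtains q where "fst q = M" "b < dens A q"
proof (rule ccontr)
  assume "\<not> thesis"
  have low: "\<And>q. fst q = M \<Longrightarrow> dens A q \<le> b"
  proof (rule leI, rule notI)
    fix q assume "fst q = M" "b < dens A q"
    then have thesis
      by (rule that)
    with \<open>\<not> thesis\<close> show False
      by contradiction
  qed
  define F where "F = first_cells p (\<lambda>q. fst q = M) M"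
  have F: "finite F" "pairwise (\<lambda>q r. disjnt (cell q) (cell r)) F"
    unfolding F_def by (rule finite_first_cells disjoint_first_cells)+
  have U: "(\<Union>q\<in>F. cell q) = cell p"
    unfolding F_def Union_first_cells using p(2) by auto
  have "dens A p * measure lebesgue (cell p) = measure lebesgue (A \<inter> (\<Union>q\<in>F. cell q))"
    by (simp add: U measure_Int_cell A)
  also have "\<dots> = (\<Sum>q\<in>F. dens A q * measure lebesgue (cell q))"
    by (rule measure_Int_UN_cells[OF F A])
  also have "\<dots> \<le> (\<Sum>q\<in>F. b * measure lebesgue (cell q))"
    by (intro sum_mono mult_right_mono low) (auto simp: F_def first_cells_def)
  also have "\<dots> = b * measure lebesgue (cell p)"
    using measure_UN_cells[OF F] by (simp add: U flip: sum_distrib_left)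
  finally show False
    using p(1) by (simp add: measure_cell)
qed

context density_modulus
begin

text \<open>A discrete intermediate value argument: on one level some cube has density above
  \<alpha> and another below, so some pair of neighbours straddles \<alpha>, and neighbours differ
  by at most \<open>w M\<close>.\<close>

lemma initial_cell_exists:
  assumes "emeasure lebesgue A > 0" "emeasure lebesgue (- A) > 0" and \<alpha>: "0 < \<alpha>" "\<alpha> < 1"
  obtains p where "m \<le> fst p" "\<bar>dens A p - \<alpha>\<bar> \<le> w (fst p)"
proof -
  have A': "- A \<in> sets lebesgue"
    using A by (simp add: Compl_in_sets_lebesgue)
  obtain p1 where p1: "m \<le> fst p1" "\<alpha> < dens A p1"
    using dense_cell_exists[OF A assms(1) \<alpha>(2)] by blast
  have "1 - \<alpha> < 1"
    using \<alpha> by simp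
  then obtain p2 where p2: "m \<le> fst p2" "1 - \<alpha> < dens (- A) p2"
    using dense_cell_exists[OF A' assms(2)] by blast
  define M where "M = max (fst p1) (fst p2)"
  obtain q1 where q1: "fst q1 = M" "\<alpha> < dens A q1"
    using dense_subcell_exists[OF A p1(2), of M] by (auto simp: M_def)
  obtain q2 where q2: "fst q2 = M" "1 - \<alpha> < dens (- A) q2"
    using dense_subcell_exists[OF A' p2(2), of M] by (auto simp: M_def)
  have "\<exists>k i. (\<alpha> < dens A (M, k + axis i 1)) \<noteq> (\<alpha> < dens A (M, k))"
  proof (rule ccontr)
    assume *: "\<nexists>k i. (\<alpha> < dens A (M, k + axis i 1)) \<noteq> (\<alpha> < dens A (M, k))"
    \<comment> \<open>If no neighbours differed, this indicator would have all increments zero and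
      be constant on the lattice.\<close>
    define f :: "int ^ 'n \<Rightarrow> real" where "f = (\<lambda>k. of_bool (\<alpha> < dens A (M, k)))"
    have "\<bar>f (snd q1) - f (snd q2)\<bar> \<le> 0 * real_of_int (\<Sum>i\<in>UNIV. \<bar>snd q1 $ i - snd q2 $ i\<bar>)"
      by (rule lattice_lipschitz) (use * in \<open>auto simp: f_def\<close>)
    moreover have "f (snd q1) = 1" "f (snd q2) = 0"
      using q1 q2 by (auto simp: f_def dens_compl[OF A] simp flip: q1(1)) (metis prod.collapse not_less_iff_gr_or_eq)
    ultimately show False
      by simp
  qed
  then obtain k i where "(\<alpha> < dens A (M, k + axis i 1)) \<noteq> (\<alpha> < dens A (M, k))"
    by blast
  then have "\<bar>dens A (M, k) - \<alpha>\<bar> \<le> w M"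
    using dens_adjacent[of M k i] by linarith
  then show thesis
    using that[of "(M, k)"] p1(1) by (simp add: M_def)
qed

end

section \<open>Choosing a lightly covered subcube\<close>

text \<open>A box may touch \<open>q\<close> in a single point. Doubling its radius makes the
  intersection contain a cube of side \<open>min (side q) r\<close>.\<close>

lemma min_power_le_overlap:
  fixes x :: "real ^ 'n"
  assumes r: "0 < r" and hit: "cube x (2 * r) \<inter> ccell q \<noteq> {}"
  shows "min (side q) r ^ CARD('n) \<le> measure lebesgue (cube x (4 * r) \<inter> cell q)"
proof -
  obtain z where z: "z \<in> cube x (2 * r)" "z \<in> ccell q"
    using hit by blast
  define \<rho> where "\<rho> = min (side q) r"
  \<comment> \<open>In each coordinate take the interval of length \<rho> that ends at
    \<open>z\<close>, moved up to the lower face of \<open>q\<close> if it would stick out. It stays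
    within \<rho> of \<open>z\<close>, hence within 2r of \<open>x\<close>.\<close>
  define b :: "real ^ 'n" where "b = (\<chi> i. max (centre q $ i - side q / 2) (z $ i - \<rho>) + \<rho> / 2)"
  have \<rho>: "0 < \<rho>" "\<rho> \<le> side q" "\<rho> \<le> r"
    using r by (auto simp: \<rho>_def)
  have sub: "cube b \<rho> \<subseteq> cube x (4 * r) \<inter> ccell q"
  proof
    fix u assume u: "u \<in> cube b \<rho>"
    have "\<bar>u $ i - x $ i\<bar> \<le> 4 * r / 2 \<and> \<bar>u $ i - centre q $ i\<bar> \<le> side q / 2" for i
    proof -
      define m where "m = max (centre q $ i - side q / 2) (z $ i - \<rho>)"
      have "\<bar>z $ i - x $ i\<bar> \<le> r"
        using z(1) by (simp add: mem_cube)
      moreover have zq: "\<bar>z $ i - centre q $ i\<bar> \<le> side q / 2"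
        using z(2) by (rule cell_near_centre)
      moreover have "centre q $ i - side q / 2 \<le> m" "z $ i - \<rho> \<le> m"
        by (simp_all add: m_def)
      moreover have "m \<le> centre q $ i + side q / 2 - \<rho>" "m \<le> z $ i"
        unfolding m_def using zq \<rho> by (intro max.boundedI; linarith)+
      moreover have "\<bar>u $ i - (m + \<rho> / 2)\<bar> \<le> \<rho> / 2"
        using u by (simp add: mem_cube b_def m_def)
      ultimately show ?thesis
        using \<rho> by linarith
    qed
    then show "u \<in> cube x (4 * r) \<inter> ccell q"
      by (simp add: mem_cube ccell_def)
  qed
  have "\<rho> ^ CARD('n) = measure lebesgue (cube b \<rho>)"
    using \<rho> by (simp add: measure_cube)
  also have "\<dots> \<le> measure lebesgue (cube x (4 * r) \<inter> ccell q)"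
    using sub by (intro measure_mono_fmeasurable) (auto simp: ccell_def intro: fmeasurableI2[OF cube_lmeasurable])
  also have "\<dots> = measure lebesgue (cube x (4 * r) \<inter> cell q)"
    unfolding cell_def ccell_def centre_def by (rule measure_Int_gcell[symmetric]) auto
  finally show ?thesis
    by (simp add: \<rho>_def)
qed

text \<open>The overlaps are disjoint pieces of the doubled box, whose volume bounds their
  sum.\<close>

lemma sum_hit_cells_le:
  fixes x :: "real ^ 'n"
  assumes r: "0 < r" and G: "finite G" "pairwise (\<lambda>q r. disjnt (cell q) (cell r)) G"
  shows "(\<Sum>q\<in>{q \<in> G. cube x (2 * r) \<inter> ccell q \<noteq> {}}. min (side q) r ^ CARD('n)) \<le> (4 * r) ^ CARD('n)"
proof -
  define H where "H = {q \<in> G. cube x (2 * r) \<inter> ccell q \<noteq> {}}"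
  have H: "finite H" "pairwise (\<lambda>q r. disjnt (cell q) (cell r)) H"
    using G by (auto simp: H_def intro: pairwise_subset)
  have "(\<Sum>q\<in>H. min (side q) r ^ CARD('n)) \<le> (\<Sum>q\<in>H. measure lebesgue (cube x (4 * r) \<inter> cell q))"
    by (intro sum_mono min_power_le_overlap[OF r]) (simp add: H_def)
  also have "\<dots> = measure lebesgue (cube x (4 * r) \<inter> (\<Union>q\<in>H. cell q))"
    by (simp add: measure_Int_UN_cells[OF H] measure_Int_cell)
  also have "\<dots> \<le> measure lebesgue (cube x (4 * r))"
    using H by (intro measure_mono_fmeasurable sets.Int sets.finite_UN) auto
  also have "\<dots> = (4 * r) ^ CARD('n)"
    using r by (simp add: measure_cube)
  finally show ?thesis
    unfolding H_def .
qed

text \<open>The total s-weight of the boxes that touch \<open>q\<close>; \<open>r i\<close> is a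
  radius, hence the side \<open>2 * r i\<close>. Closed cubes are tested because the limit point is
  only known to lie in these.\<close>

definition load :: "real \<Rightarrow> (nat \<Rightarrow> real ^ 'n) \<Rightarrow> (nat \<Rightarrow> real) \<Rightarrow> 'n::finite dyadic \<Rightarrow> real" where
  "load s x r q = (\<Sum>i. if cube (x i) (2 * r i) \<inter> ccell q \<noteq> {} then r i powr s else 0)"

lemma summable_load:
  assumes "summable (\<lambda>i. r i powr s)"
  shows "summable (\<lambda>i. if P i then r i powr s else (0 :: real))"
  by (rule summable_comparison_test'[OF assms, of 0]) auto

lemma load_ge:
  assumes "summable (\<lambda>i. r i powr s)" "cube (x i) (2 * r i) \<inter> ccell q \<noteq> {}"
  shows "r i powr s \<le> load s x r q"
proof -
  let ?f = "\<lambda>i. if cube (x i) (2 * r i) \<inter> ccell q \<noteq> {} then r i powr s else 0"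
  have "sum ?f {i} \<le> suminf ?f"
    by (rule sum_le_suminf[OF summable_load[OF assms(1)]]) auto
  then show ?thesis
    using assms(2) by (simp add: load_def)
qed

text \<open>If every cube of \<open>G\<close> were overloaded then, weighting the \<open>i\<close>-th box by
  \<open>min (side q) (r i)^n\<close> so that large boxes are charged the volume of the cubes they hit and small
  boxes are counted with multiplicity, the cubes of \<open>G\<close> would have total volume less than \<open>|p| / 16\<close>.\<close>

lemma light_child_exists:
  fixes x :: "nat \<Rightarrow> real ^ 'n" and s :: real
  assumes r: "\<And>i. 0 < r i" and s: "0 < s" "s < CARD('n)" and sum: "summable (\<lambda>i. r i powr s)"
    and G: "finite G" "pairwise (\<lambda>q r. disjnt (cell q) (cell r)) G"
    and sub: "\<And>q. q \<in> G \<Longrightarrow> cell q \<subseteq> cell p" and lvl: "\<And>q. q \<in> G \<Longrightarrow> fst p + N < fst q"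
    and vol: "measure lebesgue (cell p) / 16 \<le> (\<Sum>q\<in>G. measure lebesgue (cell q))"
    and \<eta>: "0 < \<eta>" "\<eta> \<le> 1"
    and small: "4 ^ CARD('n) * (\<eta> + (2 powr (s - CARD('n))) ^ N) < 1 / 16"
    and load: "load s x r p \<le> \<eta> * side p powr s"
  shows "\<exists>q\<in>G. load s x r q \<le> \<eta> * side q powr s"
proof (rule ccontr)
  assume "\<not> (\<exists>q\<in>G. load s x r q \<le> \<eta> * side q powr s)"
  then have heavy: "\<And>q. q \<in> G \<Longrightarrow> \<eta> * side q powr s < load s x r q"
    by (simp add: not_le del: split_paired_All split_paired_Ex)
  define n where "n = CARD('n)"
  define L where "L = side p"
  define hit where "hit = (\<lambda>i q. cube (x i) (2 * r i) \<inter> ccell q \<noteq> {})"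
  \<comment> \<open>The factor by which side^(n - s) shrinks over \<open>N\<close> generations; it
    is small when \<open>N\<close> is large because s < n.\<close>
  define \<theta> where "\<theta> = (2 powr (s - n)) ^ N"
  \<comment> \<open>Chosen so that an overloaded cube \<open>q\<close> of \<open>G\<close> satisfies
    side^n \<le> B * load.\<close>
  define B where "B = \<theta> * L powr (n - s) / \<eta>"
  define C where "C = 4 ^ n * (L powr (n - s) + B)"
  define h where "h = (\<lambda>i. if hit i p then r i powr s else 0)"
  \<comment> \<open>The charge of box \<open>i\<close> to \<open>q\<close>. The summand 1 lets a box
    larger than \<open>q\<close> pay the whole volume of \<open>q\<close>; for a smaller box the
    other summand yields exactly B * r^s.\<close>
  define t where "t = (\<lambda>i q. if hit i q then min (side q) (r i) ^ n * (1 + B * r i powr (s - n)) else 0)"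
  have L: "0 < L"
    by (simp add: L_def)
  have \<theta>: "0 < \<theta>"
    by (simp add: \<theta>_def)
  have B: "0 \<le> B" and C: "0 \<le> C"
    using \<eta> \<theta> by (simp_all add: B_def C_def)
  \<comment> \<open>A single box of radius above \<open>L\<close> touching \<open>p\<close> would
    already exceed the allowed load, as \<eta> is at most 1. This later bounds r^(n - s) by L^(n -
    s).\<close>
  have rL: "r i \<le> L" if "hit i p" for i
  proof (rule ccontr)
    assume "\<not> r i \<le> L"
    then have "L powr s < r i powr s"
      using L s by (intro powr_less_mono2) auto
    also have "r i powr s \<le> load s x r p"
      using load_ge[OF sum] that by (simp add: hit_def)
    also have "\<dots> \<le> \<eta> * L powr s"
      using load by (simp add: L_def)
    also have "\<dots> \<le> 1 * L powr s"
      using \<eta> by (intro mult_right_mono) auto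
    finally show False
      by simp
  qed
  have hit_mono: "hit i p" if "hit i q" "q \<in> G" for i q
    using that ccell_mono[OF sub[OF that(2)]] unfolding hit_def by blast
  have t0: "0 \<le> t i q" for i q
    using B r[of i] by (simp add: t_def)
  have t_sum: "(\<Sum>q\<in>G. t i q) \<le> C * h i" for i
  proof (cases "hit i p")
    case True
    have ri: "0 < r i" "r i \<le> L"
      using r rL[OF True] by auto
    have "(\<Sum>q\<in>G. t i q) = (\<Sum>q\<in>{q \<in> G. hit i q}. min (side q) (r i) ^ n) * (1 + B * r i powr (s - n))"
      using G by (auto simp: t_def sum_distrib_right sum.inter_filter intro: sum.cong)
    also have "\<dots> \<le> (4 * r i) ^ n * (1 + B * r i powr (s - n))"
      using sum_hit_cells_le[OF r[of i] G, of "x i"] B by (intro mult_right_mono) (simp_all add: n_def hit_def)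
    also have "\<dots> = 4 ^ n * (r i powr (n - s) * r i powr s + B * r i powr s)"
    proof -
      have "r i ^ n = r i powr (n - s) * r i powr s" "r i ^ n * r i powr (s - n) = r i powr s"
        using ri by (simp_all flip: powr_realpow powr_add)
      then show ?thesis
        by (simp add: power_mult_distrib algebra_simps)
    qed
    also have "\<dots> \<le> 4 ^ n * (L powr (n - s) * r i powr s + B * r i powr s)"
      using ri s by (intro mult_left_mono add_right_mono mult_right_mono powr_mono2) (auto simp: n_def)
    also have "\<dots> = C * h i"
      using True by (simp add: C_def h_def algebra_simps)
    finally show ?thesis .
  next
    case False
    then have "t i q = 0" if "q \<in> G" for q
      using hit_mono[OF _ that, of i] unfolding t_def by argo
    then show ?thesis
      using False by (simp add: h_def)
  qed
  have h_sum: "summable h"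
    unfolding h_def by (rule summable_load[OF sum])
  have t_summable: "summable (\<lambda>i. t i q)" if "q \<in> G" for q
  proof (rule summable_comparison_test'[OF summable_mult[OF h_sum, of C], of 0])
    fix i
    have "t i q \<le> (\<Sum>q\<in>G. t i q)"
      using that G t0 by (intro member_le_sum) auto
    then show "norm (t i q) \<le> C * h i"
      using t_sum[of i] t0[of i q] by simp
  qed
  \<comment> \<open>Either one box larger than \<open>q\<close> pays for the volume alone, or all
    boxes touching \<open>q\<close> are no larger than it and their charges add up to at least B *
    load.\<close>
  have cell_le: "measure lebesgue (cell q) \<le> (\<Sum>i. t i q)" if q: "q \<in> G" for q
  proof (cases "\<exists>i. hit i q \<and> side q < r i")
    case True
    then obtain i where i: "hit i q" "side q < r i"
      by blast
    have "side q ^ n * 1 \<le> side q ^ n * (1 + B * r i powr (s - n))"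
      using B by (intro mult_left_mono) auto
    then have "side q ^ n \<le> t i q"
      using i by (simp add: t_def min_def)
    also have "\<dots> = (\<Sum>i\<in>{i}. t i q)"
      by simp
    also have "\<dots> \<le> (\<Sum>i. t i q)"
      by (rule sum_le_suminf[OF t_summable[OF q]]) (use t0 in auto)
    finally show ?thesis
      by (simp add: measure_cell n_def)
  next
    case False
    have side_q: "side q powr (n - s) \<le> \<theta> * L powr (n - s)"
    proof -
      have "side q \<le> L / 2 ^ N"
      proof -
        have "(2 :: real) ^ (fst p + N) \<le> 2 ^ fst q"
          using lvl[OF q] by (intro power_increasing) auto
        then show ?thesis
          by (simp add: side_def L_def power_add field_simps)
      qed
      then have "side q powr (n - s) \<le> (L / 2 ^ N) powr (n - s)"
        using s by (intro powr_mono2) (auto simp: n_def)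
      also have "\<dots> = L powr (n - s) * (2 ^ N) powr (s - n)"
        using L by (simp add: powr_divide powr_minus_divide[of _ "n - s", simplified])
      also have "(2 ^ N :: real) powr (s - n) = \<theta>"
        by (simp add: \<theta>_def powr_powr powr_realpow[symmetric] mult.commute)
      finally show ?thesis
        by (simp add: mult.commute)
    qed
    have "\<eta> * side q ^ n = side q powr (n - s) * (\<eta> * side q powr s)"
      by (simp add: powr_realpow[symmetric] powr_add[symmetric] mult.left_commute)
    also have "\<dots> \<le> \<theta> * L powr (n - s) * load s x r q"
      using side_q heavy[OF q] \<eta> \<theta> by (intro mult_mono) auto
    finally have "side q ^ n \<le> B * load s x r q"
      using \<eta> by (simp add: B_def field_simps)
    also have "\<dots> = (\<Sum>i. B * (if hit i q then r i powr s else 0))"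
      unfolding load_def hit_def by (rule suminf_mult[symmetric]) (rule summable_load[OF sum])
    also have "\<dots> \<le> (\<Sum>i. t i q)"
    proof (rule suminf_le)
      fix i
      show "B * (if hit i q then r i powr s else 0) \<le> t i q"
      proof (cases "hit i q")
        case True
        then have "min (side q) (r i) = r i"
          using False by auto
        moreover have "r i ^ n * r i powr (s - n) = r i powr s"
          using r[of i] by (simp add: powr_realpow[symmetric] powr_add[symmetric])
        then have "r i ^ n * (1 + B * r i powr (s - n)) = r i ^ n + B * r i powr s"
          by (simp add: algebra_simps)
        moreover have "0 \<le> r i ^ n"
          using r[of i] by simp
        ultimately show ?thesis
          using True by (simp add: t_def)
      qed (simp add: t_def)
    qed (intro summable_mult summable_load[OF sum] t_summable[OF q])+
    finally show ?thesis
      by (simp add: measure_cell n_def)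
  qed
  have "L ^ n / 16 \<le> (\<Sum>q\<in>G. measure lebesgue (cell q))"
    using vol by (simp add: measure_cell L_def n_def)
  also have "\<dots> \<le> (\<Sum>q\<in>G. \<Sum>i. t i q)"
    by (rule sum_mono) (rule cell_le)
  also have "\<dots> = (\<Sum>i. \<Sum>q\<in>G. t i q)"
    by (rule suminf_sum[symmetric]) (rule t_summable)
  also have "\<dots> \<le> (\<Sum>i. C * h i)"
    by (intro suminf_le t_sum summable_sum t_summable summable_mult h_sum)
  also have "\<dots> = C * load s x r p"
    unfolding suminf_mult[OF h_sum] by (simp add: h_def hit_def load_def)
  also have "\<dots> \<le> C * (\<eta> * L powr s)"
    using load C by (intro mult_left_mono) (auto simp: L_def)
  also have "\<dots> = 4 ^ n * (\<eta> + \<theta>) * L ^ n"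
  proof -
    have "L powr (n - s) * L powr s = L ^ n"
      using L by (simp add: powr_realpow[symmetric] powr_add[symmetric])
    \<comment> \<open>The denominator \<eta> of \<open>B\<close> cancels against the load of
      \<open>p\<close>, so \<open>N\<close> need not compensate for a small \<eta> twice.\<close>
    moreover have "B * \<eta> = \<theta> * L powr (n - s)"
      using \<eta> by (simp add: B_def)
    moreover have "C * (\<eta> * L powr s) = 4 ^ n * (\<eta> * (L powr (n - s) * L powr s) + B * \<eta> * L powr s)"
      by (simp add: C_def algebra_simps)
    ultimately show ?thesis
      by (simp add: algebra_simps)
  qed
  also have "\<dots> < 1 / 16 * L ^ n"
    using small L by (intro mult_strict_right_mono) (auto simp: n_def \<theta>_def)
  finally show False
    by simp
qed

section \<open>Hausdorff dimension\<close>

context density_modulus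
begin

text \<open>The initial cube \<open>p0\<close> is fixed before the boxes are given, so
  \<open>c\<close> is uniform over all covers. A total weight at most \<open>c\<close> makes
  \<open>p0\<close> light, and repeated choice of light subcubes leads to the point.\<close>

lemma uncovered_point_exists:
  fixes s :: real
  assumes pos: "emeasure lebesgue A > 0" "emeasure lebesgue (- A) > 0" and \<alpha>: "0 < \<alpha>" "\<alpha> < 1"
    and s: "0 < s" "s < CARD('n)"
  obtains c where "0 < c" and
    "\<And>x r. (\<And>i. 0 < r i) \<Longrightarrow> summable (\<lambda>i. r i powr s) \<Longrightarrow> (\<Sum>i. r i powr s) \<le> c \<Longrightarrow>
      \<exists>u. ((\<lambda>h. set_density A (cube u h)) \<longlongrightarrow> \<alpha>) (at_right 0) \<and> (\<forall>i :: nat. u \<notin> cube (x i) (2 * r i))"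
proof -
  \<comment> \<open>With this value 4^n * 2 \<eta> = 1/32, and \<open>N\<close> is taken so large
    that the second summand in \<open>small\<close> is below \<eta> too.\<close>
  define \<eta> :: real where "\<eta> = 1 / (64 * 4 ^ CARD('n))"
  have "1 \<le> (4 :: real) ^ CARD('n)"
    by (rule one_le_power) simp
  then have "1 \<le> 64 * (4 :: real) ^ CARD('n)"
    by linarith
  then have \<eta>: "0 < \<eta>" "\<eta> \<le> 1"
    unfolding \<eta>_def by (simp, intro divide_le_eq_1_pos[THEN iffD2]) auto
  have "2 powr (s - CARD('n)) < (1 :: real)"
    using s by (simp add: powr_less_one)
  then obtain N where N: "(2 powr (s - CARD('n))) ^ N < \<eta>"
    using real_arch_pow_inv[OF \<eta>(1)] by blast
  have "4 ^ CARD('n) * (\<eta> + (2 powr (s - CARD('n))) ^ N) < 4 ^ CARD('n) * (\<eta> + \<eta>)"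
    using N by (intro mult_strict_left_mono add_strict_left_mono) auto
  also have "\<dots> < 1 / 16"
    by (simp add: \<eta>_def)
  finally have small: "4 ^ CARD('n) * (\<eta> + (2 powr (s - CARD('n))) ^ N) < 1 / 16" .
  define K where "K = real N + 3"
  have K: "0 < K"
    by (simp add: K_def)
  have Kw_lim: "(\<lambda>m. 3 * K * w m) \<longlonglongrightarrow> 0"
    using tendsto_mult_right_zero[OF w_lim, of "3 * K"] by simp
  have "eventually (\<lambda>m. 3 * K * w m < min \<alpha> (1 - \<alpha>)) sequentially"
    using \<alpha> by (intro order_tendstoD(2)[OF Kw_lim]) auto
  then obtain m0 where m0: "\<And>m. m0 \<le> m \<Longrightarrow> 3 * K * w m < min \<alpha> (1 - \<alpha>)"
    unfolding eventually_sequentially by blast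
  obtain p0 where p0: "m0 \<le> fst p0" "\<bar>dens A p0 - \<alpha>\<bar> \<le> w (fst p0)"
    using initial_cell_exists[OF pos \<alpha>] by blast
  show thesis
  proof
    show "0 < \<eta> * side p0 powr s"
      using \<eta> by simp
    fix x :: "nat \<Rightarrow> real ^ 'n" and r :: "nat \<Rightarrow> real"
    assume r: "\<And>i. 0 < r i" and sum: "summable (\<lambda>i. r i powr s)"
      and total: "(\<Sum>i. r i powr s) \<le> \<eta> * side p0 powr s"
    define good where "good = (\<lambda>p. m0 \<le> fst p \<and> \<bar>dens A p - \<alpha>\<bar> \<le> w (fst p) \<and>
      load s x r p \<le> \<eta> * side p powr s)"
    define R where "R = (\<lambda>p q. cell q \<subseteq> cell p \<and> fst p < fst q \<and>
      (\<forall>u\<in>cell q. \<forall>j. fst p \<le> j \<and> j < fst q \<longrightarrow> \<bar>dens A (dyad j u) - \<alpha>\<bar> \<le> 3 * K * w (fst p)))"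
    have "load s x r p0 \<le> (\<Sum>i. r i powr s)"
      unfolding load_def by (intro suminf_le summable_load sum) auto
    then have "good p0"
      using p0 total by (simp add: good_def)
    moreover have "\<exists>q. good q \<and> R p q" if p: "good p" for p
    proof -
      have m: "m0 \<le> fst p" and near: "\<bar>dens A p - \<alpha>\<bar> \<le> w (fst p)" and load: "load s x r p \<le> \<eta> * side p powr s"
        using p by (auto simp: good_def)
      have "3 * K * w (fst p) < \<alpha>" "3 * K * w (fst p) < 1 - \<alpha>"
        using m0[OF m] by auto
      then obtain G where G: "finite G" "pairwise (\<lambda>q r. disjnt (cell q) (cell r)) G"
        "\<And>q. q \<in> G \<Longrightarrow> cell q \<subseteq> cell p" "\<And>q. q \<in> G \<Longrightarrow> fst p + N < fst q"
        and G_near: "\<And>q. q \<in> G \<Longrightarrow> \<bar>dens A q - \<alpha>\<bar> \<le> w (fst q)"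
        and G_between: "\<And>q u j. q \<in> G \<Longrightarrow> u \<in> cell q \<Longrightarrow> fst p \<le> j \<Longrightarrow> j < fst q \<Longrightarrow>
           \<bar>dens A (dyad j u) - \<alpha>\<bar> \<le> 3 * K * w (fst p)"
        and G_vol: "measure lebesgue (cell p) / 16 \<le> (\<Sum>q\<in>G. measure lebesgue (cell q))"
        using oscillation_step[OF K_def _ _ near] by blast
      obtain q where q: "q \<in> G" "load s x r q \<le> \<eta> * side q powr s"
        using light_child_exists[OF r s sum G G_vol \<eta> small load] by blast
      have "fst p < fst q"
        using G(4)[OF q(1)] by simp
      then have "good q" "R p q"
        using q m G(3)[OF q(1)] G_near[OF q(1)] G_between[OF q(1)] by (auto simp: good_def R_def)
      then show ?thesis
        by blast
    qed
    ultimately obtain P where P: "\<And>k :: nat. good (P k)" "\<And>k. R (P k) (P (Suc k))"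
      using dependent_nat_choice[of "\<lambda>_. good" "\<lambda>_. R"] by blast
    have cell_anti: "cell (P l) \<subseteq> cell (P k)" if "k \<le> l" for k l
      using lift_Suc_antimono_le[of "\<lambda>k. cell (P k)", OF _ that] P(2) by (auto simp: R_def)
    have lvl_mono: "strict_mono (\<lambda>k. fst (P k))"
      using P(2) by (auto simp: strict_mono_Suc_iff R_def)
    have lvl_ge: "k \<le> fst (P k)" for k
      using strict_mono_imp_increasing[OF lvl_mono] by simp
    have "\<Inter>(range (\<lambda>k. ccell (P k))) \<noteq> {}"
    proof (rule compact_nest)
      show "compact (ccell (P k))" for k
        by (simp add: ccell_def cube_def)
      show "ccell (P k) \<noteq> {}" for k
        using cell_subset_ccell[of "P k"] centre_in_cell[of "P k"] by blast
      show "ccell (P l) \<subseteq> ccell (P k)" if "k \<le> l" for k l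
        by (rule ccell_mono[OF cell_anti[OF that]])
    qed
    then obtain u where u: "\<And>k. u \<in> ccell (P k)"
      by blast
    have "u \<notin> cube (x i) (2 * r i)" for i
    proof
      assume "u \<in> cube (x i) (2 * r i)"
      \<comment> \<open>A box containing \<open>u\<close> touches every \<open>P k\<close>, so its
        weight is bounded by loads that tend to zero.\<close>
      have "r i powr s \<le> \<eta> * side (P k) powr s" for k
      proof -
        have "cube (x i) (2 * r i) \<inter> ccell (P k) \<noteq> {}"
          using u \<open>u \<in> cube (x i) (2 * r i)\<close> by blast
        then have "r i powr s \<le> load s x r (P k)"
          by (rule load_ge[OF sum])
        then show ?thesis
          using P(1)[of k] by (simp add: good_def)
      qed
      moreover have "(\<lambda>k. \<eta> * side (P k) powr s) \<longlonglongrightarrow> \<eta> * 0"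
      proof (intro tendsto_mult tendsto_const)
        have "(\<lambda>j. (1 / 2 :: real) ^ j) \<longlonglongrightarrow> 0"
          by (intro LIMSEQ_realpow_zero) auto
        from LIMSEQ_subseq_LIMSEQ[OF this lvl_mono]
        have "(\<lambda>k. side (P k)) \<longlonglongrightarrow> 0"
          by (simp add: o_def side_def power_one_over)
        then show "(\<lambda>k. side (P k) powr s) \<longlonglongrightarrow> 0"
          using s by (intro tendsto_zero_powrI[where b = s]) auto
      qed
      ultimately have "r i powr s \<le> \<eta> * 0"
        by (intro LIMSEQ_le_const) auto
      then show False
        using r[of i] by simp
    qed
    moreover have "((\<lambda>h. set_density A (cube u h)) \<longlongrightarrow> \<alpha>) (at_right 0)"
    proof (rule density_tendsto)
      \<comment> \<open>The point \<open>u\<close> may lie on the boundary of the half-open cells,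
        outside all \<open>P k\<close>. Hence the dyadic ancestors of \<open>P (Suc j)\<close> are
        used instead of the cells of \<open>u\<close>; its level exceeds \<open>j\<close>.\<close>
      define c where "c = (\<lambda>j. dyad j (centre (P (Suc j))))"
      show "fst (c j) = j" for j
        by (simp add: c_def)
      show "u \<in> ccell (c j)" for j
      proof -
        have "cell (P (Suc j)) \<subseteq> cell (c j)"
          unfolding c_def using lvl_ge[of "Suc j"] by (intro cell_subset_dyad centre_in_cell) simp
        then show ?thesis
          using ccell_mono u by blast
      qed
      show "(\<lambda>j. dens A (c j)) \<longlonglongrightarrow> \<alpha>"
      proof (rule LIMSEQ_I)
        fix e :: real assume e: "0 < e"
        have "(\<lambda>k. 3 * K * w (fst (P k))) \<longlonglongrightarrow> 0"
          using LIMSEQ_subseq_LIMSEQ[OF Kw_lim lvl_mono] by (simp add: o_def)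
        then have "eventually (\<lambda>k. 3 * K * w (fst (P k)) < e) sequentially"
          using e by (rule order_tendstoD)
        then obtain k0 where k0: "\<And>k. k0 \<le> k \<Longrightarrow> 3 * K * w (fst (P k)) < e"
          unfolding eventually_sequentially by blast
        have "norm (dens A (c j) - \<alpha>) < e" if j: "fst (P k0) \<le> j" for j
        proof -
          \<comment> \<open>The generation with fst (P k) \<le> j < fst (P (Suc k)), whose corridor
            controls the density at level \<open>j\<close>.\<close>
          define k where "k = (LEAST k. j < fst (P (Suc k)))"
          have jk: "j < fst (P (Suc k))"
            unfolding k_def by (rule LeastI[of _ j]) (use lvl_ge[of "Suc j"] in simp)
          have kj: "k \<le> j"
            unfolding k_def by (rule Least_le) (use lvl_ge[of "Suc j"] in simp)
          have "fst (P k0) < fst (P (Suc k))"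
            using j jk by simp
          then have k0k: "k0 \<le> k"
            using strict_mono_less[OF lvl_mono] by simp
          have "fst (P k) \<le> j"
          proof (cases "k = k0")
            case False
            then obtain k' where k': "k = Suc k'"
              using k0k by (cases k) auto
            then have "\<not> j < fst (P (Suc k'))"
              unfolding k_def by (metis k_def lessI not_less_Least)
            then show ?thesis
              by (simp add: k')
          qed (use j in simp)
          moreover have "centre (P (Suc j)) \<in> cell (P (Suc k))"
            using cell_anti[of "Suc k" "Suc j"] kj centre_in_cell by blast
          ultimately have "\<bar>dens A (c j) - \<alpha>\<bar> \<le> 3 * K * w (fst (P k))"
            using P(2)[of k] jk unfolding R_def c_def by blast
          then show ?thesis
            using k0[OF k0k] by simp
        qed
        then show "\<exists>no. \<forall>j\<ge>no. norm (dens A (c j) - \<alpha>) < e"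
          by blast
      qed
    qed
    ultimately show "\<exists>u. ((\<lambda>h. set_density A (cube u h)) \<longlongrightarrow> \<alpha>) (at_right 0) \<and>
        (\<forall>i. u \<notin> cube (x i) (2 * r i))"
      by blast
  qed
qed

end

section \<open>Null sets and the upper bound for the dimension\<close>

lemma hausdorff_premeasure_less_iff:
  "hausdorff_premeasure s \<delta> E < c \<longleftrightarrow>
    (\<exists>U :: nat \<Rightarrow> 'a::metric_space set. E \<subseteq> (\<Union>i. U i) \<and> (\<forall>i. bounded (U i) \<and> diameter (U i) \<le> \<delta>) \<and>
      (\<Sum>i. diam_weight s (U i)) < c)"
  unfolding hausdorff_premeasure_def INF_less_iff by auto

lemma hausdorff_measure_eq_0_iff:
  "hausdorff_measure s E = 0 \<longleftrightarrow> (\<forall>\<delta>>0. \<forall>e>0. hausdorff_premeasure s \<delta> E < ennreal e)"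
proof -
  have "x = 0 \<longleftrightarrow> (\<forall>e>0. x < ennreal e)" for x
  proof
    assume *: "\<forall>e>0. x < ennreal e"
    have "x \<le> 0"
      by (rule ennreal_le_epsilon) (use * in \<open>auto intro: less_imp_le\<close>)
    then show "x = 0"
      by simp
  qed auto
  moreover have "hausdorff_measure s E = 0 \<longleftrightarrow> (\<forall>\<delta>>0. hausdorff_premeasure s \<delta> E = 0)"
    unfolding hausdorff_measure_def bot_ennreal[symmetric] SUP_bot_conv by auto
  ultimately show ?thesis
    by simp
qed

lemma hausdorff_measure_mono_null:
  assumes "hausdorff_measure s F = 0" "E \<subseteq> F"
  shows "hausdorff_measure s E = 0"
proof -
  have "hausdorff_premeasure s \<delta> E \<le> hausdorff_premeasure s \<delta> F" for \<delta>
    unfolding hausdorff_premeasure_def using assms(2) by (intro INF_superset_mono) auto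
  then show ?thesis
    using assms(1) unfolding hausdorff_measure_eq_0_iff by (meson le_less_trans)
qed

lemma hausdorff_measure_UN_null:
  assumes "\<And>a :: nat. hausdorff_measure s (E a) = 0"
  shows "hausdorff_measure s (\<Union>a. E a) = 0"
  unfolding hausdorff_measure_eq_0_iff
proof (intro allI impI)
  fix \<delta> e :: real assume "0 < \<delta>" "0 < e"
  \<comment> \<open>Summing infinitely many strict bounds gives only a weak one; the factor e / 2
    restores strictness.\<close>
  have "\<exists>V :: nat \<Rightarrow> 'a set. E a \<subseteq> (\<Union>i. V i) \<and> (\<forall>i. bounded (V i) \<and> diameter (V i) \<le> \<delta>) \<and>
      (\<Sum>i. diam_weight s (V i)) < ennreal (e / 2 * (1 / 2) ^ Suc a)" for a
    using assms[of a] \<open>0 < \<delta>\<close> \<open>0 < e\<close>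
    unfolding hausdorff_measure_eq_0_iff hausdorff_premeasure_less_iff by simp
  then obtain V :: "nat \<Rightarrow> nat \<Rightarrow> 'a set" where V: "\<And>a. E a \<subseteq> (\<Union>i. V a i)"
    "\<And>a i. bounded (V a i) \<and> diameter (V a i) \<le> \<delta>"
    "\<And>a. (\<Sum>i. diam_weight s (V a i)) < ennreal (e / 2 * (1 / 2) ^ Suc a)"
    by metis
  define U where "U = (\<lambda>i. case prod_decode i of (a, b) \<Rightarrow> V a b)"
  have "(\<Sum>i. diam_weight s (U i)) = (\<Sum>i. (\<lambda>(a, b). diam_weight s (V a b)) (prod_decode i))"
    by (simp add: U_def case_prod_beta)
  also have "\<dots> = (\<Sum>a. \<Sum>b. diam_weight s (V a b))"
    by (rule suminf_ennreal_2dimen) simp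
  also have "\<dots> \<le> (\<Sum>a. ennreal (e / 2 * (1 / 2) ^ Suc a))"
    by (intro suminf_le summableI less_imp_le V(3))
  also have "\<dots> = ennreal (e / 2 * 1)"
    using \<open>0 < e\<close> by (intro suminf_ennreal_eq sums_mult power_half_series) auto
  also have "\<dots> < ennreal e"
    using \<open>0 < e\<close> by (simp add: ennreal_less_iff)
  finally have "(\<Sum>i. diam_weight s (U i)) < ennreal e" .
  moreover have "(\<Union>a. E a) \<subseteq> (\<Union>i. U i)"
  proof
    fix y assume "y \<in> (\<Union>a. E a)"
    then obtain a b where "y \<in> V a b"
      using V(1) by blast
    then show "y \<in> (\<Union>i. U i)"
      by (intro UN_I[of "prod_encode (a, b)"]) (auto simp: U_def)
  qed
  moreover have "bounded (U i) \<and> diameter (U i) \<le> \<delta>" for i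
    using V(2) by (auto simp: U_def split: prod.split)
  ultimately show "hausdorff_premeasure s \<delta> (\<Union>a. E a) < ennreal e"
    unfolding hausdorff_premeasure_less_iff by blast
qed

lemma diameter_cell_le: "diameter (cell (q :: 'n::finite dyadic)) \<le> CARD('n) * side q"
proof (rule diameter_le)
  show "cell q \<noteq> {} \<or> 0 \<le> CARD('n) * side q"
    by simp
  fix u v assume uv: "u \<in> cell q" "v \<in> cell q"
  have "norm (u - v) \<le> (\<Sum>i\<in>UNIV. \<bar>(u - v) $ i\<bar>)"
    by (rule norm_le_l1_cart)
  also have "\<dots> \<le> (\<Sum>i\<in>(UNIV :: 'n set). side q)"
  proof (rule sum_mono)
    fix i
    show "\<bar>(u - v) $ i\<bar> \<le> side q"
      using gcell_dist[of "side q" v 0 "snd q" u i] uv unfolding cell_def by simp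
  qed
  finally show "norm (u - v) \<le> CARD('n) * side q"
    by simp
qed

text \<open>Cut \<open>p\<close> into its subcubes of level \<open>m\<close>. Each weight is at most
  a constant times the volume times (2^-m)^(s - n), and the last factor tends to zero.\<close>

lemma hausdorff_measure_cell_eq_0:
  fixes p :: "'n::finite dyadic" and s :: real
  assumes s: "CARD('n) < s"
  shows "hausdorff_measure s (cell p) = 0"
  unfolding hausdorff_measure_eq_0_iff
proof (intro allI impI)
  fix \<delta> e :: real assume \<delta>: "0 < \<delta>" and e: "0 < e"
  define n where "n = CARD('n)"
  define V where "V = measure lebesgue (cell p)"
  have s0: "0 < s"
    using s by linarith
  have "(\<lambda>m. (1 / 2 :: real) ^ m) \<longlonglongrightarrow> 0"
    by (intro LIMSEQ_realpow_zero) auto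
  then have lim: "(\<lambda>m. 1 / 2 ^ m :: real) \<longlonglongrightarrow> 0"
    by (simp add: power_one_over)
  have "(\<lambda>m. n * (1 / 2 ^ m) :: real) \<longlonglongrightarrow> 0"
    by (rule tendsto_mult_right_zero[OF lim])
  then have "eventually (\<lambda>m. n * (1 / 2 ^ m) < \<delta>) sequentially"
    using \<delta> by (rule order_tendstoD)
  moreover have "(\<lambda>m. n powr s * V * (1 / 2 ^ m) powr (s - n)) \<longlonglongrightarrow> 0"
    using s by (intro tendsto_mult_right_zero tendsto_zero_powrI[OF lim tendsto_const]) (auto simp: n_def)
  then have "eventually (\<lambda>m. n powr s * V * (1 / 2 ^ m) powr (s - n) < e) sequentially"
    using e by (rule order_tendstoD)
  moreover have "eventually (\<lambda>m. fst p \<le> m) sequentially"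
    by (rule eventually_ge_at_top)
  ultimately have "eventually (\<lambda>m. n * (1 / 2 ^ m) < \<delta> \<and> n powr s * V * (1 / 2 ^ m) powr (s - n) < e \<and> fst p \<le> m) sequentially"
    by eventually_elim simp
  then obtain m where m: "n * (1 / 2 ^ m) < \<delta>" "n powr s * V * (1 / 2 ^ m) powr (s - n) < e" "fst p \<le> m"
    unfolding eventually_sequentially by blast
  define F where "F = first_cells p (\<lambda>q. fst q = m) m"
  have F: "finite F" "pairwise (\<lambda>q r. disjnt (cell q) (cell r)) F"
    unfolding F_def by (rule finite_first_cells disjoint_first_cells)+
  have UF: "(\<Union>q\<in>F. cell q) = cell p"
    unfolding F_def Union_first_cells using m(3) by auto
  have side_F: "side q = 1 / 2 ^ m" if "q \<in> F" for q
    using that by (simp add: F_def first_cells_def side_def)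
  have VF: "V = (\<Sum>q\<in>F. measure lebesgue (cell q))"
    unfolding V_def UF[symmetric] by (rule measure_UN_cells[OF F])
  obtain g where g: "bij_betw g {0..<card F} F"
    using ex_bij_betw_nat_finite[OF F(1)] by blast
  \<comment> \<open>The finite cover is padded with empty sets, whose weight is 0.\<close>
  define U where "U = (\<lambda>i. if i < card F then cell (g i) else {})"
  have weight: "diam_weight s (cell q) \<le> ennreal (n powr s * (1 / 2 ^ m) powr (s - n) * measure lebesgue (cell q))"
    if q: "q \<in> F" for q
  proof -
    have "cell q \<noteq> {}"
      using centre_in_cell by blast
    then have "diam_weight s (cell q) = ennreal (diameter (cell q) powr s)"
      using s0 by (simp add: diam_weight_def)
    also have "diameter (cell q) powr s \<le> (n * side q) powr s"
      using diameter_cell_le[of q] s0 diameter_ge_0[OF bounded_cell[of q]] unfolding n_def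
      by (intro powr_mono2) auto
    also have "(n * side q) powr s = n powr s * side q powr (s - n) * side q ^ n"
      by (simp add: powr_mult powr_realpow[symmetric] powr_add[symmetric])
    finally show ?thesis
      by (simp add: side_F[OF q] measure_cell n_def ennreal_leI)
  qed
  have "(\<Sum>i. diam_weight s (U i)) = (\<Sum>i\<in>{0..<card F}. diam_weight s (U i))"
    by (rule suminf_finite) (auto simp: U_def diam_weight_def)
  also have "\<dots> = (\<Sum>i\<in>{0..<card F}. diam_weight s (cell (g i)))"
    by (intro sum.cong) (auto simp: U_def)
  also have "\<dots> = (\<Sum>q\<in>F. diam_weight s (cell q))"
    by (rule sum.reindex_bij_betw[OF g])
  also have "\<dots> \<le> (\<Sum>q\<in>F. ennreal (n powr s * (1 / 2 ^ m) powr (s - n) * measure lebesgue (cell q)))"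
    by (rule sum_mono) (rule weight)
  also have "\<dots> = ennreal (\<Sum>q\<in>F. n powr s * (1 / 2 ^ m) powr (s - n) * measure lebesgue (cell q))"
    by (rule sum_ennreal) simp
  also have "\<dots> = ennreal (n powr s * V * (1 / 2 ^ m) powr (s - n))"
    unfolding VF by (simp only: sum_distrib_left sum_distrib_right mult_ac)
  also have "\<dots> < ennreal e"
    using m(2) e by (simp add: ennreal_less_iff V_def)
  finally have "(\<Sum>i. diam_weight s (U i)) < ennreal e" .
  moreover have "cell p \<subseteq> (\<Union>i. U i)"
  proof
    fix y assume "y \<in> cell p"
    then obtain q where q: "q \<in> F" "y \<in> cell q"
      using UF by blast
    then obtain i where "i < card F" "g i = q"
      using bij_betw_imp_surj_on[OF g] by (metis atLeastLessThan_iff imageE)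
    then have "y \<in> U i"
      using q(2) by (simp add: U_def)
    then show "y \<in> (\<Union>i. U i)"
      by blast
  qed
  moreover have "bounded (U i) \<and> diameter (U i) \<le> \<delta>" for i
  proof (cases "i < card F")
    case True
    then have "g i \<in> F"
      using bij_betwE[OF g] by simp
    then have "diameter (cell (g i)) \<le> \<delta>"
      using diameter_cell_le[of "g i"] side_F m(1) by (simp add: n_def)
    then show ?thesis
      using True by (simp add: U_def bounded_cell)
  qed (use \<delta> in \<open>simp add: U_def\<close>)
  ultimately show "hausdorff_premeasure s \<delta> (cell p) < ennreal e"
    unfolding hausdorff_premeasure_less_iff by blast
qed

lemma hausdorff_dim_le_card:
  fixes E :: "(real ^ 'n) set"
  shows "hausdorff_dim E \<le> ereal CARD('n)"
proof (rule ereal_le_epsilon2)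
  fix e :: real assume e: "0 < e"
  have "(\<Union>a. cell (from_nat a :: 'n dyadic)) = UNIV"
    using mem_cell_dyad by (metis (mono_tags) UNIV_I UN_iff from_nat_to_nat UNIV_eq_I)
  moreover have "hausdorff_measure (CARD('n) + e) (\<Union>a. cell (from_nat a :: 'n dyadic)) = 0"
    using e by (intro hausdorff_measure_UN_null hausdorff_measure_cell_eq_0) simp
  ultimately have "hausdorff_measure (CARD('n) + e) E = 0"
    by (metis hausdorff_measure_mono_null subset_UNIV)
  then have "hausdorff_dim E \<le> ereal (CARD('n) + e)"
    unfolding hausdorff_dim_def using e by (intro INF_lower) simp
  then show "hausdorff_dim E \<le> ereal CARD('n) + ereal e"
    by simp
qed

text \<open>Passes from arbitrary covering sets to boxes of positive radius at bounded cost.\<close>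

lemma cover_by_cubes:
  fixes U :: "nat \<Rightarrow> (real ^ 'n) set"
  assumes s: "0 < s" and c: "0 < c" and U: "\<And>i. bounded (U i)"
    and total: "(\<Sum>i. diam_weight s (U i)) < ennreal c"
  obtains x r where "\<And>i. 0 < r i" "summable (\<lambda>i. r i powr s)" "(\<Sum>i. r i powr s) \<le> 2 * c"
    "\<And>i. U i \<subseteq> cube (x i) (2 * r i)"
proof -
  define d where "d = (\<lambda>i. if U i = {} then 0 else diameter (U i) powr s)"
  have d0: "0 \<le> d i" for i
    by (simp add: d_def)
  have dw: "diam_weight s (U i) = ennreal (d i)" for i
    using s by (simp add: diam_weight_def d_def)
  have less: "(\<Sum>i. ennreal (d i)) < ennreal c"
    using total by (simp add: dw)
  then have d_sum: "summable d"
    by (intro summable_suminf_not_top d0) auto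
  then have d_le: "(\<Sum>i. d i) \<le> c"
    using less c suminf_nonneg[OF d_sum d0] by (simp add: suminf_ennreal2[OF d0] ennreal_less_iff)
  \<comment> \<open>The extra terms add up to \<open>c\<close> and keep the radius positive even for
    empty sets and single points.\<close>
  define r where "r = (\<lambda>i. (d i + c * (1 / 2) ^ Suc i) powr (1 / s))"
  define x where "x = (\<lambda>i. SOME y. y \<in> U i)"
  have pos: "0 < d i + c * (1 / 2) ^ Suc i" for i
    using d0[of i] c by (intro add_nonneg_pos) auto
  have rs: "r i powr s = d i + c * (1 / 2) ^ Suc i" for i
    using s pos[of i] by (simp add: r_def powr_powr)
  have half: "(\<lambda>i. c * (1 / 2) ^ Suc i) sums (c * 1)"
    by (intro sums_mult power_half_series)
  have rs_sums: "(\<lambda>i. r i powr s) sums ((\<Sum>i. d i) + c * 1)"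
    unfolding rs by (intro sums_add summable_sums d_sum half)
  show thesis
  proof
    show "0 < r i" for i
      using pos[of i] by (simp add: r_def)
    show "summable (\<lambda>i. r i powr s)"
      using rs_sums by (rule sums_summable)
    show "(\<Sum>i. r i powr s) \<le> 2 * c"
      using sums_unique[OF rs_sums] d_le by simp
    show "U i \<subseteq> cube (x i) (2 * r i)" for i
    proof
      fix v assume v: "v \<in> U i"
      then have xi: "x i \<in> U i"
        unfolding x_def by (rule someI)
      have "dist v (x i) \<le> diameter (U i)"
        by (rule diameter_bounded_bound[OF U v xi])
      also have "diameter (U i) = d i powr (1 / s)"
        using v s diameter_ge_0[OF U, of i] by (auto simp: d_def powr_powr)
      also have "\<dots> \<le> r i"
        unfolding r_def using s d0[of i] c by (intro powr_mono2) auto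
      finally have *: "dist v (x i) \<le> r i" .
      have "\<bar>v $ l - x i $ l\<bar> \<le> r i" for l
        using component_le_norm_cart[of "v - x i" l] * by (simp add: dist_norm)
      then show "v \<in> cube (x i) (2 * r i)"
        by (simp add: mem_cube)
    qed
  qed
qed

theorem theorem1:
  fixes A :: "(real ^ 'n) set" and \<alpha> :: real
  assumes "smooth_set A"
    and "emeasure lebesgue A > 0"
    and "emeasure lebesgue (- A) > 0"
    and "0 < \<alpha>" and "\<alpha> < 1"
  shows "hausdorff_dim {x. ((\<lambda>h. set_density A (cube x h)) \<longlongrightarrow> \<alpha>) (at_right 0)} = ereal (real CARD('n))"
proof (rule antisym)
  let ?E = "{x. ((\<lambda>h. set_density A (cube x h)) \<longlongrightarrow> \<alpha>) (at_right 0)}"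
  show "hausdorff_dim ?E \<le> ereal CARD('n)"
    by (rule hausdorff_dim_le_card)
  have A: "A \<in> sets lebesgue"
    using assms(1) by (simp add: smooth_set_def)
  obtain w :: "nat \<Rightarrow> real" where "density_modulus A w"
  proof (rule smooth_set_modulus[OF assms(1)])
    fix w :: "nat \<Rightarrow> real"
    assume w: "antimono w" "\<And>m. 0 < w m" "w \<longlonglongrightarrow> 0"
      "\<And>m x y h l. 0 < l \<Longrightarrow> l \<le> h \<Longrightarrow> h \<le> 2 * l \<Longrightarrow> h \<le> 2 / 2 ^ m \<Longrightarrow> (\<And>i. \<bar>x $ i - y $ i\<bar> \<le> h) \<Longrightarrow>
        \<bar>set_density A (cube x h) - set_density A (cube y l)\<bar> \<le> w m"
    show thesis
      by (rule that[of w], unfold_locales) (use A w in auto)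
  qed
  then interpret density_modulus A w .
  \<comment> \<open>A null set would have a cover light enough for the previous construction, which
    yields a point of the set outside all boxes.\<close>
  have not_null: "hausdorff_measure s ?E \<noteq> 0" if s: "0 < s" "s < CARD('n)" for s :: real
  proof
    assume null: "hausdorff_measure s ?E = 0"
    obtain c where c: "0 < c" and point:
      "\<And>x r. (\<And>i. 0 < r i) \<Longrightarrow> summable (\<lambda>i. r i powr s) \<Longrightarrow> (\<Sum>i. r i powr s) \<le> c \<Longrightarrow>
        \<exists>u. ((\<lambda>h. set_density A (cube u h)) \<longlongrightarrow> \<alpha>) (at_right 0) \<and> (\<forall>i :: nat. u \<notin> cube (x i) (2 * r i))"
      using uncovered_point_exists[OF assms(2-5) s] by blast
    have "hausdorff_premeasure s 1 ?E < ennreal (c / 2)"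
      using null c unfolding hausdorff_measure_eq_0_iff by simp
    then obtain U :: "nat \<Rightarrow> (real ^ 'n) set" where U: "?E \<subseteq> (\<Union>i. U i)" "\<And>i. bounded (U i)"
      "(\<Sum>i. diam_weight s (U i)) < ennreal (c / 2)"
      unfolding hausdorff_premeasure_less_iff by blast
    obtain x r where xr: "\<And>i. 0 < r i" "summable (\<lambda>i. r i powr s)" "(\<Sum>i. r i powr s) \<le> 2 * (c / 2)"
      "\<And>i. U i \<subseteq> cube (x i) (2 * r i)"
      using cover_by_cubes[OF s(1) _ U(2,3)] c by (metis half_gt_zero)
    obtain u where "u \<in> ?E" "\<forall>i. u \<notin> cube (x i) (2 * r i)"
      using point[of r x] xr(1-3) by auto
    then show False
      using U(1) xr(4) by blast
  qed
  show "ereal CARD('n) \<le> hausdorff_dim ?E"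
    unfolding hausdorff_dim_def
  proof (rule INF_greatest)
    fix s assume "s \<in> {s. 0 \<le> s \<and> hausdorff_measure s ?E = 0}"
    then have s: "0 \<le> s" "hausdorff_measure s ?E = 0"
      by auto
    show "ereal CARD('n) \<le> ereal s"
    proof (cases "s = 0")
      \<comment> \<open>Since \<open>not_null\<close> speaks of positive exponents, exponent 0 is
        treated by counting: total weight below 1 forces every covering set, and so the set itself,
        to be empty. But the empty set is null for the exponent 1/2, against
        \<open>not_null\<close>.\<close>
      case True
      have "hausdorff_premeasure 0 1 ?E < ennreal 1"
        using s(2) unfolding True hausdorff_measure_eq_0_iff by (meson zero_less_one)
      then obtain U :: "nat \<Rightarrow> (real ^ 'n) set" where U: "?E \<subseteq> (\<Union>i. U i)" "(\<Sum>i. diam_weight 0 (U i)) < 1"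
        unfolding hausdorff_premeasure_less_iff by auto
      have "U i = {}" for i
      proof (rule ccontr)
        assume "U i \<noteq> {}"
        then have "1 = (\<Sum>i\<in>{i}. diam_weight 0 (U i))"
          by (simp add: diam_weight_def)
        also have "\<dots> \<le> (\<Sum>i. diam_weight 0 (U i))"
          by (rule sum_le_suminf) auto
        finally show False
          using U(2) by simp
      qed
      then have empty: "?E = {}"
        using U(1) by auto
      have "hausdorff_measure (1 / 2) ({} :: (real ^ 'n) set) = 0"
        unfolding hausdorff_measure_eq_0_iff hausdorff_premeasure_less_iff
        by (auto intro!: exI[of _ "\<lambda>_. {}"] simp: diam_weight_def)
      moreover have "0 < (1 / 2 :: real)" "1 / 2 < real CARD('n)"
        using zero_less_card_finite[where 'a = 'n] by linarith+
      note not_null[OF this, unfolded empty]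
      ultimately show ?thesis
        by contradiction
    next
      case False
      then show ?thesis
        using not_null[of s] s by force
    qed
  qed
qed

end
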